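(* Let $k:\mathcal P\otimes\mathcal Q\to\mathbb R$ be differentiable at $P_0\otimes Q_0$ with canonical gradient $\widetilde k=\widetilde k_1\circ\pi_1+\widetilde k_2\circ\pi_2$, let $\alpha\in(0,1)$, and let $(n_1)_n,(n_2)_n\subset\mathbb N$ satisfy $n_1+n_2=n$ for all $n$ and $\lim_{n\to\infty}\frac{n_2}n=d\in(0,1)$. Let $t\mapsto P_t\otimes Q_t$ be an $L_2(P_0\otimes Q_0)$-differentiable curve in $\mathcal P\otimes\mathcal Q$ with tangent $g\in L_2^{(0)}(P_0\otimes Q_0)$. Assume $$\int\widetilde k^2\,dP_0\otimes Q_0\neq0\qquad\text{and}\qquad\int\widetilde kg\,dP_0\otimes Q_0\neq0.$$ Let $(t_n)_n$ be a sequence with $t_n\to0$ and $$k(P_{t_n}\otimes Q_{t_n})=k(P_0\otimes Q_0)+n^{-1/2}\vartheta+o(n^{-1/2})$$ for some $\vartheta\in\mathbb R\setminus\{0\}$. Let $\psi_n=1$ if $T_n>c$ and $\psi_n=0$ if $T_n\le c$, where $$T_n=\frac{\sqrt n}{n_1}\sum_{i=1}^{n_1}\widetilde k_1(\omega_{1,i})+\frac{\sqrt n}{n_2}\sum_{j=1}^{n_2}\widetilde k_2(\omega_{2,j}),\qquad c=u_{1-\alpha}\Bigl(\frac1{1-d}\int\widetilde k_1^2\,dP_0+\frac1d\int\widetilde k_2^2\,dQ_0\Bigr)^{1/2}.$$ Then $(\psi_n)$ is asymptotically $\{0\}$-$\alpha$-similar, i.e. $\lim_{n\to\infty}\int\psi_n\,dP_0^{n_1}\otimes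 Q_0^{n_2}=\alpha$, and $$\lim_{n\to\infty}\int\psi_n\,dP_{t_n}^{n_1}\otimes Q_{t_n}^{n_2}=\Phi\Bigl(\vartheta\Bigl(\frac1{1-d}\int\widetilde k_1^2\,dP_0+\frac1d\int\widetilde k_2^2\,dQ_0\Bigr)^{-1/2}-u_{1-\alpha}\Bigr).$$ In particular, for $\vartheta<0$ the sequence $(\psi_n)$ asymptotically keeps the level $\alpha$, i.e. this limit is at most $\alpha$.
   Context: $\mathcal P,\mathcal Q$ are nonempty families of probability measures on $(\Omega_1,\mathcal A_1)$, $(\Omega_2,\mathcal A_2)$; $\mathcal P\otimes\mathcal Q=\{P\otimes Q:P\in\mathcal P,Q\in\mathcal Q\}$; $(\omega_{1,1},\dots,\omega_{1,n_1},\omega_{2,1},\dots,\omega_{2,n_2})$ is the generic point of $\Omega_1^{n_1}\times\Omega_2^{n_2}$. $\Phi$ is the standard normal distribution function and $u_{1-\alpha}=\Phi^{-1}(1-\alpha)$. $L_2^{(0)}(P)=\{h\in L_2(P):\int h\,dP=0\}$. With $dP/dQ$ the density quotient (a $[0,\infty]$-valued measurable $L$ with $P(A)=\int_AL\,dQ+P(A\cap\{L=\infty\})$, $Q(L<\infty)=1$), a curve $t\mapsto R_t$, $|t|<\varepsilon$, in a family $\mathcal R$ is $L_2(R_0)$-differentiable with tangent $g\in L_2(R_0)$ if $\|2((dR_t/dR_0)^{1/2}-1)-tg\|_{L_2(R_0)}=o(|t|)$ and $R_t(dR_t/dR_0=\infty)=o(t^2)$ as $t\to0$. A functional $k$ on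 $\mathcal R$ is differentiable at $R\in\mathcal R$ with gradient $\dot k\in L_2^{(0)}(R)$ if $\lim_{t\downarrow0}t^{-1}(k(R_t)-k(R))=\int\dot kg\,dR$ for each $L_2$-differentiable curve in $\mathcal R$ with $R_0=R$ and tangent $g$; the canonical gradient is the unique gradient in the tangent space $T(R,\mathcal R)$, the $L_2(R)$-closure of the linear span of all such tangents. At $P_0\otimes Q_0$ the canonical gradient decomposes uniquely as $\widetilde k(\omega_1,\omega_2)=\widetilde k_1(\omega_1)+\widetilde k_2(\omega_2)$ with $\widetilde k_1\in L_2^{(0)}(P_0)$, $\widetilde k_2\in L_2^{(0)}(Q_0)$. *)

theory Defs
  imports "HOL-Probability.Probability" "HOL-Library.Landau_Symbols"
begin

text \<open>Elements of \<open>L\<^sub>2\<close> are represented by functions, not by classes of functions that agree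
  almost everywhere.\<close>

definition L2 :: "'a measure \<Rightarrow> ('a \<Rightarrow> real) set" where
  "L2 M = {h \<in> borel_measurable M. integrable M (\<lambda>x. (h x)\<^sup>2)}"

definition L2_zero :: "'a measure \<Rightarrow> ('a \<Rightarrow> real) set" where
  "L2_zero M = {h \<in> L2 M. (\<integral>x. h x \<partial>M) = 0}"

definition L2_norm :: "'a measure \<Rightarrow> ('a \<Rightarrow> real) \<Rightarrow> real" where
  "L2_norm M h = sqrt (\<integral>x. (h x)\<^sup>2 \<partial>M)"

definition density_quotient :: "'a measure \<Rightarrow> 'a measure \<Rightarrow> ('a \<Rightarrow> ennreal) \<Rightarrow> bool" where
  "density_quotient P Q L \<longleftrightarrow>
     L \<in> borel_measurable Q \<and>
     (\<forall>A\<in>sets Q. emeasure P A =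
        (\<integral>\<^sup>+x\<in>A. L x \<partial>Q) + emeasure P (A \<inter> {x \<in> space Q. L x = \<infinity>})) \<and>
     emeasure Q {x \<in> space Q. L x < \<infinity>} = 1"

text \<open>A density quotient is unique up to a set that is null for both measures, so it does not
  matter which versions \<open>L t\<close> are used below. Under \<open>R 0\<close> they are finite almost everywhere,
  hence \<open>enn2real\<close> loses nothing inside the norm. Only the values of \<open>R\<close> on the
  interval from \<open>-\<epsilon>\<close> to \<open>\<epsilon>\<close> matter.\<close>

definition L2_differentiable ::
    "real \<Rightarrow> (real \<Rightarrow> 'a measure) \<Rightarrow> ('a \<Rightarrow> real) \<Rightarrow> bool" where
  "L2_differentiable \<epsilon> R g \<longleftrightarrow>
     \<epsilon> > 0 \<and> g \<in> L2 (R 0) \<and>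
     (\<exists>L. (\<forall>t. \<bar>t\<bar> < \<epsilon> \<longrightarrow> density_quotient (R t) (R 0) (L t)) \<and>
        (\<lambda>t. L2_norm (R 0) (\<lambda>x. 2 * (sqrt (enn2real (L t x)) - 1) - t * g x))
          \<in> o[at 0](\<lambda>t. \<bar>t\<bar>) \<and>
        (\<lambda>t. measure (R t) {x \<in> space (R t). L t x = \<infinity>}) \<in> o[at 0](\<lambda>t. t\<^sup>2))"

definition differentiable_curve ::
    "'a measure set \<Rightarrow> real \<Rightarrow> (real \<Rightarrow> 'a measure) \<Rightarrow> ('a \<Rightarrow> real) \<Rightarrow> bool" where
  "differentiable_curve \<R> \<epsilon> R g \<longleftrightarrow>
     (\<forall>t. \<bar>t\<bar> < \<epsilon> \<longrightarrow> R t \<in> \<R>) \<and> L2_differentiable \<epsilon> R g"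

definition tangents :: "'a measure set \<Rightarrow> 'a measure \<Rightarrow> ('a \<Rightarrow> real) set" where
  "tangents \<R> M = {g. \<exists>\<epsilon> R. differentiable_curve \<R> \<epsilon> R g \<and> R 0 = M}"

definition linear_span :: "('a \<Rightarrow> real) set \<Rightarrow> ('a \<Rightarrow> real) set" where
  "linear_span G = {\<lambda>x. \<Sum>i<m. c i * h i x | (m::nat) c h. \<forall>i<m. h i \<in> G}"

definition tangent_space :: "'a measure set \<Rightarrow> 'a measure \<Rightarrow> ('a \<Rightarrow> real) set" where
  "tangent_space \<R> M =
     {h \<in> L2 M. \<forall>e>0. \<exists>f\<in>linear_span (tangents \<R> M). L2_norm M (\<lambda>x. h x - f x) < e}"

definition gradient ::
    "'a measure set \<Rightarrow> ('a measure \<Rightarrow> real) \<Rightarrow> 'a measure \<Rightarrow> ('a \<Rightarrow> real) \<Rightarrow> bool" where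
  "gradient \<R> k M kd \<longleftrightarrow>
     M \<in> \<R> \<and> kd \<in> L2_zero M \<and>
     (\<forall>\<epsilon> R g. differentiable_curve \<R> \<epsilon> R g \<and> R 0 = M \<longrightarrow>
        ((\<lambda>t. (k (R t) - k M) / t) \<longlongrightarrow> (\<integral>x. kd x * g x \<partial>M)) (at_right 0))"

text \<open>The canonical gradient is unique only almost everywhere, hence a predicate.\<close>

definition canonical_gradient ::
    "'a measure set \<Rightarrow> ('a measure \<Rightarrow> real) \<Rightarrow> 'a measure \<Rightarrow> ('a \<Rightarrow> real) \<Rightarrow> bool" where
  "canonical_gradient \<R> k M kt \<longleftrightarrow> gradient \<R> k M kt \<and> kt \<in> tangent_space \<R> M"

definition product_family ::
    "'a measure set \<Rightarrow> 'b measure set \<Rightarrow> ('a \<times> 'b) measure set" where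
  "product_family \<P> \<Q> = {P \<Otimes>\<^sub>M Q | P Q. P \<in> \<P> \<and> Q \<in> \<Q>}"

definition sample_measure ::
    "'a measure \<Rightarrow> 'b measure \<Rightarrow> nat \<Rightarrow> nat \<Rightarrow> ((nat \<Rightarrow> 'a) \<times> (nat \<Rightarrow> 'b)) measure" where
  "sample_measure P Q m1 m2 = (\<Pi>\<^sub>M i\<in>{1..m1}. P) \<Otimes>\<^sub>M (\<Pi>\<^sub>M j\<in>{1..m2}. Q)"

definition std_normal_cdf :: "real \<Rightarrow> real" where
  "std_normal_cdf = cdf std_normal_distribution"

definition std_normal_quantile :: "real \<Rightarrow> real" where
  "std_normal_quantile = inv std_normal_cdf"

definition asymp_variance ::
    "'a measure \<Rightarrow> 'b measure \<Rightarrow> ('a \<Rightarrow> real) \<Rightarrow> ('b \<Rightarrow> real) \<Rightarrow> real \<Rightarrow> real" where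
  "asymp_variance P Q k1 k2 d =
     1 / (1 - d) * (\<integral>x. (k1 x)\<^sup>2 \<partial>P) + 1 / d * (\<integral>y. (k2 y)\<^sup>2 \<partial>Q)"

definition test_statistic ::
    "('a \<Rightarrow> real) \<Rightarrow> ('b \<Rightarrow> real) \<Rightarrow> nat \<Rightarrow> nat \<Rightarrow> nat \<Rightarrow> (nat \<Rightarrow> 'a) \<times> (nat \<Rightarrow> 'b) \<Rightarrow> real" where
  "test_statistic k1 k2 n m1 m2 = (\<lambda>(x, y).
     sqrt (real n) / real m1 * (\<Sum>i=1..m1. k1 (x i)) +
     sqrt (real n) / real m2 * (\<Sum>j=1..m2. k2 (y j)))"

definition critical_value ::
    "real \<Rightarrow> 'a measure \<Rightarrow> 'b measure \<Rightarrow> ('a \<Rightarrow> real) \<Rightarrow> ('b \<Rightarrow> real) \<Rightarrow> real \<Rightarrow> real" where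
  "critical_value \<alpha> P Q k1 k2 d =
     std_normal_quantile (1 - \<alpha>) * sqrt (asymp_variance P Q k1 k2 d)"

end

theory Submission
  imports Defs
begin

text \<open>The characteristic function of the test statistic under \<open>P\<^sub>t \<otimes> Q\<^sub>t\<close> is a product of powers of
  \<open>\<integral> exp (i b h) dR\<^sub>t\<close>, where \<open>R\<^sub>t = P\<^sub>t \<otimes> Q\<^sub>t\<close>, \<open>h\<close> is one of the two parts of the canonical gradient and
  \<open>b\<close> is of order \<open>n\<^sup>-\<^sup>1\<^sup>/\<^sup>2\<close>. The \<open>L\<^sub>2\<close>-expansion of the root density of the product curve gives
  \<open>\<integral> exp (i b h) dR\<^sub>t = 1 - b\<^sup>2/2 \<integral> h\<^sup>2 dR\<^sub>0 + i t b \<integral> g h dR\<^sub>0 + o(1/n)\<close> for \<open>t = O(n\<^sup>-\<^sup>1\<^sup>/\<^sup>2)\<close>, so that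
  neither marginal tangents nor contiguity are needed, and Levy's continuity theorem yields normal
  limits. The differentiability of \<open>k\<close>, used along the curve and along its reversal because \<open>t\<^sub>n\<close>
  may have either sign, shows that \<open>n\<^sup>1\<^sup>/\<^sup>2 t\<^sub>n\<close> tends to \<open>\<theta> / \<integral> k g\<close>; the limiting mean is therefore \<open>\<theta>\<close>.
  The null hypothesis is the case of a constant curve.\<close>

section \<open>Square integrable functions and density quotients\<close>

lemma L2_mult_integrable:
  assumes "f \<in> L2 M" "g \<in> L2 M"
  shows "integrable M (\<lambda>x. f x * g x)"
proof (rule Bochner_Integration.integrable_bound)
  show "integrable M (\<lambda>x. (f x)\<^sup>2 + (g x)\<^sup>2)"
    using assms by (auto simp: L2_def)
  show "(\<lambda>x. f x * g x) \<in> borel_measurable M"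
    using assms by (auto simp: L2_def)
  have "\<bar>f x * g x\<bar> \<le> (f x)\<^sup>2 + (g x)\<^sup>2" for x
    using sum_squares_bound[of "\<bar>f x\<bar>" "\<bar>g x\<bar>"] abs_ge_zero[of "f x * g x"]
    unfolding abs_mult power2_abs by linarith
  then show "AE x in M. norm (f x * g x) \<le> norm ((f x)\<^sup>2 + (g x)\<^sup>2)"
    by simp
qed

lemma L2_add:
  assumes "f \<in> L2 M" "g \<in> L2 M"
  shows "(\<lambda>x. f x + g x) \<in> L2 M"
proof -
  have "integrable M (\<lambda>x. (f x)\<^sup>2 + (g x)\<^sup>2 + 2 * (f x * g x))"
    using assms L2_mult_integrable[OF assms] by (auto simp: L2_def)
  then show ?thesis
    using assms by (auto simp: L2_def power2_sum mult.assoc)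
qed

lemma L2_cmult:
  assumes "f \<in> L2 M"
  shows "(\<lambda>x. c * f x) \<in> L2 M"
  using assms by (auto simp: L2_def power_mult_distrib)

lemma L2_abs:
  assumes "f \<in> L2 M"
  shows "(\<lambda>x. \<bar>f x\<bar>) \<in> L2 M"
  using assms by (auto simp: L2_def)

lemma (in finite_measure) L2_integrable:
  assumes "f \<in> L2 M"
  shows "integrable M f"
  by (rule square_integrable_imp_integrable) (use assms in \<open>auto simp: L2_def\<close>)

text \<open>Cauchy-Schwarz, transferred from the extended nonnegative integral. It later bounds the
  product of \<open>h\<close> with the remainder of the root density, of which only the norm is
  known.\<close>

lemma integral_abs_mult_le_L2_norm:
  assumes f: "f \<in> L2 M" and g: "g \<in> L2 M"
  shows "(\<integral>x. \<bar>f x\<bar> * \<bar>g x\<bar> \<partial>M) \<le> L2_norm M f * L2_norm M g"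
proof -
  have [measurable]: "f \<in> borel_measurable M" "g \<in> borel_measurable M"
    and sq: "integrable M (\<lambda>x. (f x)\<^sup>2)" "integrable M (\<lambda>x. (g x)\<^sup>2)"
    using f g by (auto simp: L2_def)
  have fg: "integrable M (\<lambda>x. \<bar>f x\<bar> * \<bar>g x\<bar>)"
    by (intro L2_mult_integrable L2_abs f g)
  have "(\<integral>\<^sup>+x. ennreal \<bar>f x\<bar> * ennreal \<bar>g x\<bar> \<partial>M)\<^sup>2
      \<le> (\<integral>\<^sup>+x. (ennreal \<bar>f x\<bar>)\<^sup>2 \<partial>M) * (\<integral>\<^sup>+x. (ennreal \<bar>g x\<bar>)\<^sup>2 \<partial>M)"
    by (rule Cauchy_Schwarz_nn_integral) auto
  also have "(\<integral>\<^sup>+x. (ennreal \<bar>f x\<bar>)\<^sup>2 \<partial>M) = ennreal (\<integral>x. (f x)\<^sup>2 \<partial>M)"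
    using sq by (simp add: ennreal_power nn_integral_eq_integral)
  also have "(\<integral>\<^sup>+x. (ennreal \<bar>g x\<bar>)\<^sup>2 \<partial>M) = ennreal (\<integral>x. (g x)\<^sup>2 \<partial>M)"
    using sq by (simp add: ennreal_power nn_integral_eq_integral)
  also have "(\<integral>\<^sup>+x. ennreal \<bar>f x\<bar> * ennreal \<bar>g x\<bar> \<partial>M) = ennreal (\<integral>x. \<bar>f x\<bar> * \<bar>g x\<bar> \<partial>M)"
    using fg by (simp add: ennreal_mult[symmetric] nn_integral_eq_integral)
  finally have "(\<integral>x. \<bar>f x\<bar> * \<bar>g x\<bar> \<partial>M)\<^sup>2 \<le> (\<integral>x. (f x)\<^sup>2 \<partial>M) * (\<integral>x. (g x)\<^sup>2 \<partial>M)"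
    by (simp add: ennreal_power ennreal_mult[symmetric])
  then show ?thesis
    unfolding L2_norm_def real_sqrt_mult[symmetric] by (rule real_le_rsqrt)
qed

lemma norm_integral_le:
  fixes f :: "'a \<Rightarrow> 'b::{banach, second_countable_topology}"
  assumes "integrable M f" "integrable M g" "\<And>x. x \<in> space M \<Longrightarrow> norm (f x) \<le> g x"
  shows "norm (\<integral>x. f x \<partial>M) \<le> (\<integral>x. g x \<partial>M)"
  by (rule order_trans[OF integral_norm_bound integral_mono]) (use assms in auto)

text \<open>Where \<open>L\<close> is finite, \<open>R\<close> has density \<open>L\<close> with
  respect to \<open>M\<close>. Integrating a bounded \<open>f\<close> against \<open>L\<close>
  therefore misses only the mass that \<open>R\<close> puts on the set where \<open>L\<close> is
  infinite.\<close>

lemma density_quotient_integral: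
  fixes f :: "'a \<Rightarrow> complex"
  assumes R: "prob_space R" and M: "prob_space M" and sets: "sets R = sets M"
    and L: "density_quotient R M L"
    and f[measurable]: "f \<in> borel_measurable M" and bound: "\<And>x. cmod (f x) \<le> B"
  shows "integrable M (\<lambda>x. enn2real (L x))"
    and "cmod ((\<integral>x. f x \<partial>R) - (\<integral>x. enn2real (L x) *\<^sub>R f x \<partial>M))
      \<le> B * measure R {x \<in> space R. L x = \<infinity>}"
proof -
  interpret R: prob_space R by fact
  interpret M: prob_space M by fact
  note sets[measurable_cong]
  have space: "space R = space M" using sets by (rule sets_eq_imp_space_eq)
  have [measurable]: "L \<in> borel_measurable M" using L by (simp add: density_quotient_def)
  define N where "N = {x \<in> space M. L x = \<infinity>}"
  have N[measurable]: "N \<in> sets M" unfolding N_def by measurable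
  define C where "C = space M - N"
  have C[measurable]: "C \<in> sets M" unfolding C_def by measurable
  have fin: "AE x in M. L x < \<infinity>"
    using L by (subst M.AE_iff_emeasure_eq_1) (auto simp: density_quotient_def)
  \<comment> \<open>Both sides describe the part of \<open>R\<close> that is absolutely continuous
    with respect to \<open>M\<close>.\<close>
  have eq: "density R (\<lambda>x. ennreal (indicat_real C x)) = density M (\<lambda>x. ennreal (enn2real (L x)))"
  proof (rule measure_eqI)
    show "sets (density R (\<lambda>x. ennreal (indicat_real C x))) = sets (density M (\<lambda>x. ennreal (enn2real (L x))))"
      using sets by simp
    fix A assume "A \<in> sets (density R (\<lambda>x. ennreal (indicat_real C x)))"
    then have A[measurable]: "A \<in> sets M" "A \<in> sets R" using sets by auto
    have [measurable]: "C \<in> sets R" using sets C by simp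
    have "emeasure (density R (\<lambda>x. ennreal (indicat_real C x))) A
        = (\<integral>\<^sup>+x. indicator (A \<inter> C) x \<partial>R)"
      using A(2) by (simp add: emeasure_density) (auto intro!: nn_integral_cong split: split_indicator simp flip: nn_integral_indicator)
    also have "\<dots> = emeasure R (A \<inter> C)" by (intro nn_integral_indicator) simp
    \<comment> \<open>The defining identity of the density quotient is applied to
      \<open>A \<inter> C\<close> rather than \<open>A\<close>, so that its singular term
      vanishes.\<close>
    also have "\<dots> = (\<integral>\<^sup>+x\<in>A \<inter> C. L x \<partial>M) + emeasure R ((A \<inter> C) \<inter> N)"
      using L A(1) C unfolding density_quotient_def N_def by blast
    also have "(A \<inter> C) \<inter> N = {}" by (auto simp: C_def)
    also have "(\<integral>\<^sup>+x\<in>A \<inter> C. L x \<partial>M) = (\<integral>\<^sup>+x\<in>A. ennreal (enn2real (L x)) \<partial>M)"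
    proof (rule nn_integral_cong_AE)
      show "AE x in M. L x * indicator (A \<inter> C) x = ennreal (enn2real (L x)) * indicator A x"
        using fin AE_space by eventually_elim (auto simp: C_def N_def split: split_indicator)
    qed
    also have "\<dots> = emeasure (density M (\<lambda>x. ennreal (enn2real (L x)))) A"
      by (simp add: emeasure_density)
    finally show "emeasure (density R (\<lambda>x. ennreal (indicat_real C x))) A
        = emeasure (density M (\<lambda>x. ennreal (enn2real (L x)))) A"
      by simp
  qed
  have [measurable]: "C \<in> sets R" "N \<in> sets R" using sets by auto
  \<comment> \<open>The absolutely continuous part is a finite measure, so the constant 1 is
    integrable for it; read on the side of \<open>M\<close>, this says that the density is
    integrable.\<close>
  have "integrable (density R (\<lambda>x. ennreal (indicat_real C x))) (\<lambda>x. 1::real)"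
    by (subst integrable_density) (auto intro: R.integrable_const_bound[where B=1])
  then show "integrable M (\<lambda>x. enn2real (L x))"
    unfolding eq by (subst (asm) integrable_density) auto
  have [measurable]: "f \<in> borel_measurable R" by measurable
  have "(\<integral>x. enn2real (L x) *\<^sub>R f x \<partial>M) = integral\<^sup>L (density M (\<lambda>x. ennreal (enn2real (L x)))) f"
    by (rule integral_density[symmetric]) auto
  also have "\<dots> = (\<integral>x. indicat_real C x *\<^sub>R f x \<partial>R)"
    unfolding eq[symmetric] by (rule integral_density) auto
  finally have eq2: "(\<integral>x. enn2real (L x) *\<^sub>R f x \<partial>M) = (\<integral>x. indicat_real C x *\<^sub>R f x \<partial>R)" .
  have "0 \<le> B" by (rule order_trans[OF norm_ge_zero bound])
  have int_f: "integrable R f"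
    using bound by (intro R.integrable_const_bound[where B=B]) auto
  have int_C: "integrable R (\<lambda>x. indicat_real C x *\<^sub>R f x)"
    using int_f by (rule integrable_mult_indicator[rotated]) simp
  have "(\<integral>x. f x \<partial>R) - (\<integral>x. enn2real (L x) *\<^sub>R f x \<partial>M) = (\<integral>x. f x - indicat_real C x *\<^sub>R f x \<partial>R)"
    unfolding eq2 using int_f int_C by (simp add: Bochner_Integration.integral_diff)
  also have "cmod \<dots> \<le> (\<integral>x. B * indicat_real N x \<partial>R)"
  proof (rule norm_integral_le)
    show "integrable R (\<lambda>x. f x - indicat_real C x *\<^sub>R f x)" using int_f int_C by simp
    show "integrable R (\<lambda>x. B * indicat_real N x)"
      by (auto intro: R.integrable_const_bound[where B=1])
    show "cmod (f x - indicat_real C x *\<^sub>R f x) \<le> B * indicat_real N x" if "x \<in> space R" for x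
      using that bound[of x] \<open>0 \<le> B\<close> by (auto simp: C_def space split: split_indicator)
  qed
  also have "\<dots> = B * measure R N" by simp
  finally show "cmod ((\<integral>x. f x \<partial>R) - (\<integral>x. enn2real (L x) *\<^sub>R f x \<partial>M))
      \<le> B * measure R {x \<in> space R. L x = \<infinity>}"
    by (simp add: N_def space)
qed

text \<open>Dominated convergence with majorant \<open>\<phi>\<close>: pointwise the minimum tends
  to \<open>min (\<phi> x) 0 = 0\<close>. Since \<open>\<psi>\<close> is merely measurable, it may
  contain third powers such as \<open>|h|^3\<close>.\<close>

lemma (in finite_measure) integral_min_tendsto_0:
  fixes b :: "nat \<Rightarrow> real"
  assumes phi: "integrable M \<phi>" "\<And>x. 0 \<le> \<phi> x"
    and psi[measurable]: "\<psi> \<in> borel_measurable M" and psi0: "\<And>x. 0 \<le> \<psi> x"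
    and b: "b \<longlonglongrightarrow> 0"
  shows "(\<lambda>n. \<integral>x. min (\<phi> x) (\<bar>b n\<bar> * \<psi> x) \<partial>M) \<longlonglongrightarrow> 0"
proof -
  have [measurable]: "\<phi> \<in> borel_measurable M" using phi by simp
  have "(\<lambda>n. \<integral>x. min (\<phi> x) (\<bar>b n\<bar> * \<psi> x) \<partial>M) \<longlonglongrightarrow> (\<integral>x. 0 \<partial>M)"
  proof (rule integral_dominated_convergence[where w=\<phi>])
    have "(\<lambda>n. min (\<phi> x) (\<bar>b n\<bar> * \<psi> x)) \<longlonglongrightarrow> min (\<phi> x) (\<bar>0\<bar> * \<psi> x)" for x
      by (intro tendsto_intros b)
    then show "AE x in M. (\<lambda>n. min (\<phi> x) (\<bar>b n\<bar> * \<psi> x)) \<longlonglongrightarrow> 0"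
      using phi(2) by (simp add: min_absorb2)
    show "AE x in M. norm (min (\<phi> x) (\<bar>b n\<bar> * \<psi> x)) \<le> \<phi> x" for n
      using phi(2) psi0 by (auto simp: min_def)
  qed (use phi in auto)
  then show ?thesis by simp
qed

lemma (in finite_measure) integrable_min:
  assumes phi: "integrable M \<phi>" "\<And>x. 0 \<le> \<phi> x"
    and psi[measurable]: "\<psi> \<in> borel_measurable M" and psi0: "\<And>x. 0 \<le> \<psi> x"
  shows "integrable M (\<lambda>x. min (\<phi> x :: real) (\<bar>b\<bar> * \<psi> x))"
proof (rule Bochner_Integration.integrable_bound[OF phi(1)])
  have [measurable]: "\<phi> \<in> borel_measurable M" using phi by simp
  show "(\<lambda>x. min (\<phi> x) (\<bar>b\<bar> * \<psi> x)) \<in> borel_measurable M" by measurable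
  show "AE x in M. norm (min (\<phi> x) (\<bar>b\<bar> * \<psi> x)) \<le> norm (\<phi> x)"
    using phi(2) psi0 by (auto simp: min_def)
qed

section \<open>Expansion of characteristic functions along differentiable curves\<close>

text \<open>Taylor remainders of orders 0, 1 and 2. In each minimum the first bound controls large
  \<open>y\<close> with no more than the available moments, and the second gains a power of
  \<open>y\<close> for small \<open>y\<close>.\<close>

lemma iexp_remainders:
  fixes y :: real
  shows "cmod (iexp y - 1) \<le> min 2 \<bar>y\<bar>"
    and "cmod (iexp y - 1 - \<i> * y) \<le> min (2 * \<bar>y\<bar>) (y\<^sup>2 / 2)"
    and "cmod (iexp y - 1 - \<i> * y + y\<^sup>2 / 2) \<le> min (y\<^sup>2) (\<bar>y\<bar> ^ 3 / 6)"
proof -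
  show "cmod (iexp y - 1) \<le> min 2 \<bar>y\<bar>"
    using iexp_approx1[of y 0] iexp_approx2[of y 0] by simp
  show "cmod (iexp y - 1 - \<i> * y) \<le> min (2 * \<bar>y\<bar>) (y\<^sup>2 / 2)"
    using iexp_approx1[of y 1] iexp_approx2[of y 1]
    by (simp add: diff_diff_eq power2_eq_square abs_mult_self_eq)
  have *: "(\<Sum>k\<le>2. (\<i> * y)^k / fact k) = 1 + \<i> * y - y\<^sup>2 / 2"
    by (simp add: numeral_2_eq_2[symmetric] atMost_nat_numeral power_mult_distrib algebra_simps)
  show "cmod (iexp y - 1 - \<i> * y + y\<^sup>2 / 2) \<le> min (y\<^sup>2) (\<bar>y\<bar> ^ 3 / 6)"
    using iexp_approx1[of y 2] iexp_approx2[of y 2] unfolding *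
    by (simp add: algebra_simps fact_numeral numeral_eq_Suc)
qed

text \<open>A complex form of \<open>(1 + w/m)^m\<close> tending to \<open>exp w\<close>. In the
  closed unit disc \<open>m\<close>-th powers satisfy \<open>|z^m - v^m| \<le> m |z - v|\<close>, so
  \<open>z\<close> may be replaced by any \<open>v\<close> in the disc with the same limit of
  \<open>m (v - 1)\<close>.\<close>

lemma power_tendsto_exp:
  fixes z :: "nat \<Rightarrow> complex" and m :: "nat \<Rightarrow> nat"
  assumes z: "\<And>n. cmod (z n) \<le> 1" and m: "filterlim m at_top sequentially"
    and lim: "(\<lambda>n. of_nat (m n) * (z n - 1)) \<longlonglongrightarrow> w" and w: "Re w \<le> 0"
  shows "(\<lambda>n. z n ^ m n) \<longlonglongrightarrow> exp w"
proof -
  \<comment> \<open>The comparison sequence is an exact \<open>m\<close>-th root of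
    \<open>exp w\<close>. It lies in the unit disc because \<open>Re w \<le> 0\<close>.\<close>
  define v where "v n = exp (w / of_nat (m n))" for n
  have v: "cmod (v n) \<le> 1" for n
    using w by (auto simp: v_def divide_nonpos_nonneg)
  have ev: "eventually (\<lambda>n. m n > 0) sequentially"
    using m by (rule eventually_compose_filterlim[OF eventually_gt_at_top])
  have vm: "eventually (\<lambda>n. v n ^ m n = exp w) sequentially"
    using ev by eventually_elim (simp add: v_def exp_of_nat_mult[symmetric])
  \<comment> \<open>The difference quotient of \<open>exp (w * x)\<close> at 0, taken along
    \<open>x = 1 / m n\<close>, is \<open>m n * (v n - 1)\<close>.\<close>
  have "((\<lambda>x. exp (w * x)) has_field_derivative w) (at 0)"
    by (auto intro!: derivative_eq_intros)
  then have D: "((\<lambda>x. (exp (w * x) - 1) / x) \<longlongrightarrow> w) (at 0)"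
    by (simp add: DERIV_def)
  have "filterlim (\<lambda>n. inverse (of_nat (m n) :: complex)) (at 0) sequentially"
  proof (rule filterlim_atI)
    show "(\<lambda>n. inverse (of_nat (m n) :: complex)) \<longlonglongrightarrow> 0"
      by (intro filterlim_compose[OF tendsto_inverse_0] filterlim_compose[OF tendsto_of_nat m])
    show "eventually (\<lambda>n. inverse (of_nat (m n) :: complex) \<noteq> 0) sequentially"
      using ev by eventually_elim simp
  qed
  from filterlim_compose[OF D this]
  have lim2: "(\<lambda>n. of_nat (m n) * (v n - 1)) \<longlonglongrightarrow> w"
    by (simp add: v_def field_simps)
  have "(\<lambda>n. z n ^ m n - v n ^ m n) \<longlonglongrightarrow> 0"
  proof (rule Lim_null_comparison)
    have "cmod (z n ^ m n - v n ^ m n) \<le> cmod (of_nat (m n) * (z n - 1) - of_nat (m n) * (v n - 1))" for n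
      using norm_power_diff[OF z[of n] v[of n], of "m n"]
      by (simp add: right_diff_distrib[symmetric] norm_mult)
    then show "eventually (\<lambda>n. cmod (z n ^ m n - v n ^ m n) \<le>
        cmod (of_nat (m n) * (z n - 1) - of_nat (m n) * (v n - 1))) sequentially"
      by simp
    show "(\<lambda>n. cmod (of_nat (m n) * (z n - 1) - of_nat (m n) * (v n - 1))) \<longlonglongrightarrow> 0"
      using tendsto_norm[OF tendsto_diff[OF lim lim2]] by simp
  qed
  moreover have "(\<lambda>n. v n ^ m n) \<longlonglongrightarrow> exp w"
    using vm by (rule tendsto_eventually)
  ultimately show ?thesis
    using tendsto_add by fastforce
qed

text \<open>The truncations by \<open>min\<close> make every remainder integrable under second moments alone, while
  dominated convergence still lets the integrals vanish as \<open>b\<close> tends to \<open>0\<close>.\<close>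

lemma char_expansion_bound:
  fixes b t :: real and h g :: "'a \<Rightarrow> real" and L :: "'a \<Rightarrow> ennreal"
  assumes R: "prob_space R" and M: "prob_space M" and sets: "sets R = sets M"
    and L: "density_quotient R M L" and h: "h \<in> L2_zero M" and g: "g \<in> L2 M"
  defines "\<delta> \<equiv> L2_norm M (\<lambda>x. 2 * (sqrt (enn2real (L x)) - 1) - t * g x)"
  shows "cmod ((\<integral>x. iexp (b * h x) \<partial>R) - 1
        - (\<i> * (t * b * (\<integral>x. g x * h x \<partial>M)) - b\<^sup>2 / 2 * (\<integral>x. (h x)\<^sup>2 \<partial>M)))
      \<le> b\<^sup>2 * (\<integral>x. min ((h x)\<^sup>2) (\<bar>b\<bar> * (\<bar>h x\<bar> ^ 3 / 6)) \<partial>M)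
        + \<bar>t * b\<bar> * (\<integral>x. min (2 * (\<bar>g x\<bar> * \<bar>h x\<bar>)) (\<bar>b\<bar> * (\<bar>g x\<bar> * (h x)\<^sup>2 / 2)) \<partial>M)
        + \<bar>b\<bar> * (\<delta> * L2_norm M h)
        + t\<^sup>2 / 2 * (\<integral>x. min (2 * (g x)\<^sup>2) (\<bar>b\<bar> * ((g x)\<^sup>2 * \<bar>h x\<bar>)) \<partial>M)
        + \<delta>\<^sup>2 + 2 * measure R {x \<in> space R. L x = \<infinity>}" (is "_ \<le> ?rhs")
proof -
  interpret R: prob_space R by fact
  interpret M: prob_space M by fact
  note sets[measurable_cong]
  have h2: "h \<in> L2 M" and h0: "(\<integral>x. h x \<partial>M) = 0" using h by (auto simp: L2_zero_def)
  have [measurable]: "h \<in> borel_measurable M" "g \<in> borel_measurable M" "L \<in> borel_measurable M"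
    using h2 g L by (auto simp: L2_def density_quotient_def)
  have ih: "integrable M h" "integrable M (\<lambda>x. (h x)\<^sup>2)" "integrable M (\<lambda>x. g x * h x)"
      "integrable M (\<lambda>x. (g x)\<^sup>2)" "integrable M (\<lambda>x. \<bar>g x\<bar> * \<bar>h x\<bar>)"
    using h2 g M.L2_integrable[OF h2] L2_mult_integrable[OF g h2]
      L2_mult_integrable[OF L2_abs[OF g] L2_abs[OF h2]] by (auto simp: L2_def)
  \<comment> \<open>Subtracting 1 gives an integrand bounded by 2 and also by \<open>|b h|\<close>;
    the small bound supplies the additional factor \<open>b\<close> in the error terms.\<close>
  define f where "f x = iexp (b * h x) - 1" for x
  have f[measurable]: "f \<in> borel_measurable M" unfolding f_def by measurable
  have f_le: "cmod (f x) \<le> min 2 \<bar>b * h x\<bar>" for x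
    unfolding f_def by (rule iexp_remainders)
  then have f2: "cmod (f x) \<le> 2" and f1: "cmod (f x) \<le> \<bar>b\<bar> * \<bar>h x\<bar>" for x
    unfolding abs_mult by (meson min.boundedE)+
  define \<rho> where "\<rho> x = enn2real (L x)" for x
  have \<rho>: "integrable M \<rho>" "cmod ((\<integral>x. f x \<partial>R) - (\<integral>x. \<rho> x *\<^sub>R f x \<partial>M))
      \<le> 2 * measure R {x \<in> space R. L x = \<infinity>}"
    using density_quotient_integral[OF R M sets L f f2] by (auto simp: \<rho>_def[abs_def])
  have [measurable]: "\<rho> \<in> borel_measurable M" using \<rho>(1) by simp
  have \<rho>0: "\<rho> x \<ge> 0" for x by (simp add: \<rho>_def)
  \<comment> \<open>The remainder of the root density, whose norm is \<open>\<delta>\<close>. It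
    lies in \<open>L2 M\<close> because \<open>\<rho>\<close> is integrable, hence its root square
    integrable.\<close>
  define u where "u x = 2 * (sqrt (\<rho> x) - 1) - t * g x" for x
  have "(\<lambda>x. sqrt (\<rho> x)) \<in> L2 M"
    using \<rho>(1) \<rho>0 by (simp add: L2_def)
  moreover have "(\<lambda>x. -2) \<in> L2 M" by (simp add: L2_def)
  ultimately have "(\<lambda>x. (2 * sqrt (\<rho> x) + -2) + (- t) * g x) \<in> L2 M"
    by (intro L2_add L2_cmult g)
  then have u: "u \<in> L2 M" by (simp add: u_def[abs_def] algebra_simps)
  then have [measurable]: "u \<in> borel_measurable M" and iu: "integrable M (\<lambda>x. (u x)\<^sup>2)"
    by (auto simp: L2_def)
  have \<delta>: "\<delta> = L2_norm M u" by (simp add: \<delta>_def u_def[abs_def] \<rho>_def)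
  have iuh: "integrable M (\<lambda>x. \<bar>u x\<bar> * \<bar>h x\<bar>)"
    by (intro L2_mult_integrable L2_abs u h2)
  \<comment> \<open>What is left of \<open>\<rho> f\<close> after removing the leading terms. The
    linear term \<open>\<i> b h\<close> is removed too, at no cost, because \<open>h\<close> has
    integral 0.\<close>
  define r where "r x = \<rho> x *\<^sub>R f x - \<i> * (b * h x) - \<i> * (t * b * (g x * h x)) + b\<^sup>2 / 2 * (h x)\<^sup>2" for x
  have i\<rho>f: "integrable M (\<lambda>x. \<rho> x *\<^sub>R f x)"
  proof (rule Bochner_Integration.integrable_bound)
    show "integrable M (\<lambda>x. 2 * \<rho> x)" using \<rho>(1) by simp
    have "\<rho> x * cmod (f x) \<le> 2 * \<rho> x" for x
      using mult_left_mono[OF f2 \<rho>0] by (simp add: mult.commute)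
    then show "AE x in M. norm (\<rho> x *\<^sub>R f x) \<le> norm (2 * \<rho> x)"
      using \<rho>0 by simp
  qed simp
  have cint: "complex_integrable M (\<lambda>x. \<i> * (b * h x))"
      "complex_integrable M (\<lambda>x. \<i> * (t * b * (g x * h x)))"
      "complex_integrable M (\<lambda>x. complex_of_real (b\<^sup>2 / 2 * (h x)\<^sup>2))"
    using ih by (auto simp del: of_real_mult)
  have ir: "integrable M r"
    unfolding r_def[abs_def] using i\<rho>f cint by auto
  have int_r: "(\<integral>x. r x \<partial>M) = (\<integral>x. \<rho> x *\<^sub>R f x \<partial>M)
      - (\<i> * (t * b * (\<integral>x. g x * h x \<partial>M)) - b\<^sup>2 / 2 * (\<integral>x. (h x)\<^sup>2 \<partial>M))"
    unfolding r_def[abs_def] using i\<rho>f cint h0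
    by (simp add: of_real_mult[symmetric] del: of_real_mult)
  let ?J1 = "\<lambda>x. min ((h x)\<^sup>2) (\<bar>b\<bar> * (\<bar>h x\<bar> ^ 3 / 6))"
  let ?J2 = "\<lambda>x. min (2 * (\<bar>g x\<bar> * \<bar>h x\<bar>)) (\<bar>b\<bar> * (\<bar>g x\<bar> * (h x)\<^sup>2 / 2))"
  let ?J3 = "\<lambda>x. min (2 * (g x)\<^sup>2) (\<bar>b\<bar> * ((g x)\<^sup>2 * \<bar>h x\<bar>))"
  let ?B = "\<lambda>x. b\<^sup>2 * ?J1 x + \<bar>t * b\<bar> * ?J2 x + \<bar>b\<bar> * (\<bar>u x\<bar> * \<bar>h x\<bar>) + t\<^sup>2 / 2 * ?J3 x + (u x)\<^sup>2"
  have r_le: "cmod (r x) \<le> ?B x" for x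
  proof -
    \<comment> \<open>Expands \<open>\<rho>\<close> from \<open>\<rho>\<^sup>1\<^sup>/\<^sup>2 = 1 + (t g + u) / 2\<close>; the density itself has no controlled \<open>L\<^sub>2\<close>-expansion.\<close>
    have sq: "\<rho> x = 1 + (t * g x + u x) + (t * g x + u x)\<^sup>2 / 4"
    proof -
      have "sqrt (\<rho> x) = 1 + (t * g x + u x) / 2" by (simp add: u_def field_simps)
      then have "\<rho> x = (1 + (t * g x + u x) / 2)\<^sup>2" using \<rho>0 by (metis real_sqrt_pow2)
      then show ?thesis by (simp add: power2_eq_square algebra_simps)
    qed
    let ?y = "b * h x"
    \<comment> \<open>The summands belong to the four terms of
      \<open>\<rho> = 1 + t g + u + (t g + u)^2 / 4\<close>: the term 1 absorbs the Taylor
      polynomial of order 2, the term \<open>t g\<close> that of order 1, and the other two meet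
      \<open>f\<close> itself.\<close>
    have "r x = (f x - \<i> * ?y + ?y\<^sup>2 / 2) + (t * g x) *\<^sub>R (f x - \<i> * ?y) + u x *\<^sub>R f x
        + ((t * g x + u x)\<^sup>2 / 4) *\<^sub>R f x"
      unfolding r_def sq by (simp add: scaleR_conv_of_real algebra_simps power_mult_distrib)
    then have "cmod (r x) \<le> cmod (f x - \<i> * ?y + ?y\<^sup>2 / 2) + cmod ((t * g x) *\<^sub>R (f x - \<i> * ?y))
        + cmod (u x *\<^sub>R f x) + cmod (((t * g x + u x)\<^sup>2 / 4) *\<^sub>R f x)"
      by (metis norm_triangle_le norm_triangle_ineq add_mono order_refl)
    also have "cmod (f x - \<i> * ?y + ?y\<^sup>2 / 2) \<le> b\<^sup>2 * ?J1 x"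
    proof -
      have b3: "\<bar>b\<bar> ^ 3 = b\<^sup>2 * \<bar>b\<bar>"
        by (simp add: power3_eq_cube power2_eq_square)
      have "b\<^sup>2 * ?J1 x = min (?y\<^sup>2) (\<bar>?y\<bar> ^ 3 / 6)"
        by (simp add: min_mult_distrib_left power_mult_distrib abs_mult b3 mult.assoc)
      with iexp_remainders(3)[of ?y] show ?thesis by (simp add: f_def)
    qed
    also have "cmod ((t * g x) *\<^sub>R (f x - \<i> * ?y)) \<le> \<bar>t * b\<bar> * ?J2 x"
    proof -
      have b2: "b\<^sup>2 = \<bar>b\<bar> * \<bar>b\<bar>"
        by (simp add: power2_eq_square)
      have "\<bar>t * b\<bar> * ?J2 x = \<bar>t * g x\<bar> * min (2 * \<bar>?y\<bar>) (?y\<^sup>2 / 2)"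
        by (simp add: min_mult_distrib_left power_mult_distrib abs_mult b2 mult_ac del: abs_mult_self_eq)
      moreover have "\<bar>t * g x\<bar> * cmod (f x - \<i> * ?y) \<le> \<bar>t * g x\<bar> * min (2 * \<bar>?y\<bar>) (?y\<^sup>2 / 2)"
        using iexp_remainders(2)[of ?y] by (intro mult_left_mono) (auto simp: f_def)
      ultimately show ?thesis by simp
    qed
    also have "cmod (u x *\<^sub>R f x) \<le> \<bar>b\<bar> * (\<bar>u x\<bar> * \<bar>h x\<bar>)"
      using mult_left_mono[OF f1[of x] abs_ge_zero[of "u x"]] by (simp add: mult.left_commute)
    also have "cmod (((t * g x + u x)\<^sup>2 / 4) *\<^sub>R f x) \<le> t\<^sup>2 / 2 * ?J3 x + (u x)\<^sup>2"
    proof -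
      \<comment> \<open>Separates the tangent from the remainder. The tangent part then keeps the
        bound \<open>min 2 |b h|\<close> of \<open>f\<close>, which makes its integral vanish with
        \<open>b\<close>, while the constant 2 suffices for \<open>u\<close>.\<close>
      have "(t * g x + u x)\<^sup>2 \<le> 2 * (t * g x)\<^sup>2 + 2 * (u x)\<^sup>2"
        using sum_squares_bound[of "t * g x" "u x"] by (simp add: power2_sum)
      then have "(t * g x + u x)\<^sup>2 / 4 * cmod (f x) \<le> ((t * g x)\<^sup>2 / 2 + (u x)\<^sup>2 / 2) * cmod (f x)"
        by (intro mult_right_mono) auto
      also have "\<dots> = (t * g x)\<^sup>2 / 2 * cmod (f x) + (u x)\<^sup>2 / 2 * cmod (f x)"
        by (simp add: distrib_right)
      also have "\<dots> \<le> (t * g x)\<^sup>2 / 2 * min 2 \<bar>?y\<bar> + (u x)\<^sup>2 / 2 * 2"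
        by (intro add_mono mult_left_mono f_le f2) auto
      also have "\<dots> = t\<^sup>2 / 2 * ?J3 x + (u x)\<^sup>2"
        by (simp add: min_mult_distrib_left power_mult_distrib abs_mult mult_ac)
      finally show ?thesis by simp
    qed
    finally show ?thesis by simp
  qed
  have iJ: "integrable M ?J1" "integrable M ?J2" "integrable M ?J3"
    by (rule M.integrable_min; use ih in simp)+
  have "cmod (\<integral>x. r x \<partial>M) \<le> (\<integral>x. ?B x \<partial>M)"
    by (rule norm_integral_le[OF ir _ r_le]) (use iJ iuh iu in auto)
  also have "\<dots> = b\<^sup>2 * (\<integral>x. ?J1 x \<partial>M) + \<bar>t * b\<bar> * (\<integral>x. ?J2 x \<partial>M)
      + \<bar>b\<bar> * (\<integral>x. \<bar>u x\<bar> * \<bar>h x\<bar> \<partial>M) + t\<^sup>2 / 2 * (\<integral>x. ?J3 x \<partial>M) + \<delta>\<^sup>2"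
    unfolding \<delta> L2_norm_def using iJ iuh iu by simp
  also have "\<dots> \<le> b\<^sup>2 * (\<integral>x. ?J1 x \<partial>M) + \<bar>t * b\<bar> * (\<integral>x. ?J2 x \<partial>M)
      + \<bar>b\<bar> * (\<delta> * L2_norm M h) + t\<^sup>2 / 2 * (\<integral>x. ?J3 x \<partial>M) + \<delta>\<^sup>2"
    unfolding \<delta> by (intro add_mono mult_left_mono integral_abs_mult_le_L2_norm u h2) auto
  finally have r_int: "cmod (\<integral>x. r x \<partial>M) \<le> \<dots>" .
  have [measurable]: "h \<in> borel_measurable R" by measurable
  have "integrable R (\<lambda>x. iexp (b * h x))"
    by (rule R.integrable_const_bound[where B=1]) (auto simp: norm_exp_i_times)
  then have "(\<integral>x. iexp (b * h x) \<partial>R) - 1 = (\<integral>x. f x \<partial>R)"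
    unfolding f_def by (subst Bochner_Integration.integral_diff) (auto simp: R.prob_space)
  \<comment> \<open>The total error is the integral of \<open>r\<close> plus the error of passing
    from \<open>R\<close> to the density \<open>\<rho>\<close>; the latter is at most twice the
    singular mass.\<close>
  then have eq: "(\<integral>x. iexp (b * h x) \<partial>R) - 1
        - (\<i> * (t * b * (\<integral>x. g x * h x \<partial>M)) - b\<^sup>2 / 2 * (\<integral>x. (h x)\<^sup>2 \<partial>M))
      = (\<integral>x. r x \<partial>M) + ((\<integral>x. f x \<partial>R) - (\<integral>x. \<rho> x *\<^sub>R f x \<partial>M))"
    unfolding int_r by simp
  have "cmod ((\<integral>x. r x \<partial>M) + ((\<integral>x. f x \<partial>R) - (\<integral>x. \<rho> x *\<^sub>R f x \<partial>M))) \<le> ?rhs"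
    using norm_triangle_ineq[of "\<integral>x. r x \<partial>M" "(\<integral>x. f x \<partial>R) - (\<integral>x. \<rho> x *\<^sub>R f x \<partial>M)"] r_int \<rho>(2)
    by linarith
  then show ?thesis
    by (simp only: eq)
qed

text \<open>Multiplying the expansion bound by \<open>m\<close> leaves only null terms: the
  truncated integrals vanish with \<open>b\<close>, while \<open>\<delta> = o(|t|)\<close> and
  singular mass \<open>o(t^2)\<close> are what differentiability of the curve provides.\<close>

lemma char_expansion_limit:
  fixes R :: "real \<Rightarrow> 'a measure" and h g :: "'a \<Rightarrow> real" and t b :: "nat \<Rightarrow> real" and m :: "nat \<Rightarrow> nat"
  assumes diff: "L2_differentiable \<epsilon> R g"
    and R: "\<And>s. \<bar>s\<bar> < \<epsilon> \<Longrightarrow> prob_space (R s) \<and> sets (R s) = sets (R 0)"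
    and h: "h \<in> L2_zero (R 0)"
    and t: "filterlim t (at 0) sequentially"
    and b: "b \<longlonglongrightarrow> 0"
    and A: "(\<lambda>n. m n * (b n)\<^sup>2) \<longlonglongrightarrow> A"
    and B: "(\<lambda>n. m n * (t n * b n)) \<longlonglongrightarrow> B"
    and C: "(\<lambda>n. m n * (t n)\<^sup>2) \<longlonglongrightarrow> C"
  shows "(\<lambda>n. of_nat (m n) * ((\<integral>x. iexp (b n * h x) \<partial>R (t n)) - 1))
    \<longlonglongrightarrow> complex_of_real (- (A / 2 * (\<integral>x. (h x)\<^sup>2 \<partial>R 0))) + \<i> * (B * (\<integral>x. g x * h x \<partial>R 0))"
proof -
  obtain L where \<epsilon>: "\<epsilon> > 0" and g: "g \<in> L2 (R 0)"
    and L: "\<And>s. \<bar>s\<bar> < \<epsilon> \<Longrightarrow> density_quotient (R s) (R 0) (L s)"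
    and o1: "(\<lambda>s. L2_norm (R 0) (\<lambda>x. 2 * (sqrt (enn2real (L s x)) - 1) - s * g x)) \<in> o[at 0](\<lambda>s. \<bar>s\<bar>)"
    and o2: "(\<lambda>s. measure (R s) {x \<in> space (R s). L s x = \<infinity>}) \<in> o[at 0](\<lambda>s. s\<^sup>2)"
    using diff unfolding L2_differentiable_def by blast
  interpret M: prob_space "R 0" using R[of 0] \<epsilon> by auto
  have h2: "h \<in> L2 (R 0)" using h by (simp add: L2_zero_def)
  have [measurable]: "h \<in> borel_measurable (R 0)" "g \<in> borel_measurable (R 0)"
    using h2 g by (auto simp: L2_def)
  have ih: "integrable (R 0) (\<lambda>x. (h x)\<^sup>2)" "integrable (R 0) (\<lambda>x. (g x)\<^sup>2)"
      "integrable (R 0) (\<lambda>x. \<bar>g x\<bar> * \<bar>h x\<bar>)"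
    using h2 g L2_mult_integrable[OF L2_abs[OF g] L2_abs[OF h2]] by (auto simp: L2_def)
  define \<delta> where "\<delta> n = L2_norm (R 0) (\<lambda>x. 2 * (sqrt (enn2real (L (t n) x)) - 1) - t n * g x)" for n
  define \<kappa> where "\<kappa> n = measure (R (t n)) {x \<in> space (R (t n)). L (t n) x = \<infinity>}" for n
  have t_ne: "eventually (\<lambda>n. t n \<noteq> 0) sequentially" and t0: "t \<longlonglongrightarrow> 0"
    using t by (auto simp: filterlim_at)
  have t_eps: "eventually (\<lambda>n. \<bar>t n\<bar> < \<epsilon>) sequentially"
    using order_tendstoD(2)[OF tendsto_rabs[OF t0], of \<epsilon>] \<epsilon> by simp
  have d1: "(\<lambda>n. \<delta> n / \<bar>t n\<bar>) \<longlonglongrightarrow> 0"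
    using smalloD_tendsto[OF landau_o.small.compose[OF o1 t]] by (simp add: \<delta>_def)
  have d2: "(\<lambda>n. \<kappa> n / (t n)\<^sup>2) \<longlonglongrightarrow> 0"
    using smalloD_tendsto[OF landau_o.small.compose[OF o2 t]] by (simp add: \<kappa>_def)
  define J1 where "J1 n = (\<integral>x. min ((h x)\<^sup>2) (\<bar>b n\<bar> * (\<bar>h x\<bar> ^ 3 / 6)) \<partial>R 0)" for n
  define J2 where "J2 n = (\<integral>x. min (2 * (\<bar>g x\<bar> * \<bar>h x\<bar>)) (\<bar>b n\<bar> * (\<bar>g x\<bar> * (h x)\<^sup>2 / 2)) \<partial>R 0)" for n
  define J3 where "J3 n = (\<integral>x. min (2 * (g x)\<^sup>2) (\<bar>b n\<bar> * ((g x)\<^sup>2 * \<bar>h x\<bar>)) \<partial>R 0)" for n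
  have J: "J1 \<longlonglongrightarrow> 0" "J2 \<longlonglongrightarrow> 0" "J3 \<longlonglongrightarrow> 0"
    unfolding J1_def[abs_def] J2_def[abs_def] J3_def[abs_def]
    by (rule M.integral_min_tendsto_0; use ih b in simp)+
  let ?c = "\<lambda>n. \<i> * (t n * b n * (\<integral>x. g x * h x \<partial>R 0)) - (b n)\<^sup>2 / 2 * (\<integral>x. (h x)\<^sup>2 \<partial>R 0)"
  let ?E = "\<lambda>n. (\<integral>x. iexp (b n * h x) \<partial>R (t n)) - 1"
  \<comment> \<open>Each summand pairs \<open>m\<close> with \<open>b^2\<close>, \<open>t b\<close>
    or \<open>t^2\<close>, whose products converge, and multiplies this by a factor tending to
    0.\<close>
  let ?U = "\<lambda>n. m n * (b n)\<^sup>2 * J1 n + \<bar>m n * (t n * b n)\<bar> * J2 n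
      + \<bar>m n * (t n * b n)\<bar> * (\<delta> n / \<bar>t n\<bar>) * L2_norm (R 0) h
      + m n * (t n)\<^sup>2 / 2 * J3 n + m n * (t n)\<^sup>2 * (\<delta> n / \<bar>t n\<bar>)\<^sup>2 + 2 * (m n * (t n)\<^sup>2) * (\<kappa> n / (t n)\<^sup>2)"
  have "(\<lambda>n. of_nat (m n) * ?E n - of_nat (m n) * ?c n) \<longlonglongrightarrow> 0"
  proof (rule Lim_null_comparison)
    show "eventually (\<lambda>n. norm (of_nat (m n) * ?E n - of_nat (m n) * ?c n) \<le> ?U n) sequentially"
      using t_ne t_eps
    proof eventually_elim
      case (elim n)
      have "norm (of_nat (m n) * ?E n - of_nat (m n) * ?c n) = m n * cmod (?E n - ?c n)"
        unfolding right_diff_distrib[of "of_nat (m n)" "?E n" "?c n", symmetric] norm_mult norm_of_nat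
        by (rule refl)
      also have "\<dots> \<le> m n * ((b n)\<^sup>2 * J1 n + \<bar>t n * b n\<bar> * J2 n + \<bar>b n\<bar> * (\<delta> n * L2_norm (R 0) h)
          + (t n)\<^sup>2 / 2 * J3 n + (\<delta> n)\<^sup>2 + 2 * \<kappa> n)"
        unfolding J1_def J2_def J3_def \<delta>_def \<kappa>_def
        by (rule mult_left_mono[OF char_expansion_bound of_nat_0_le_iff])
          (use R[of "t n"] R[of 0] L[of "t n"] h g elim \<epsilon> in \<open>(simp; fail)+\<close>)
      also have "\<dots> = ?U n"
      proof -
        define D K where "D = \<delta> n / \<bar>t n\<bar>" and "K = \<kappa> n / (t n)\<^sup>2"
        have "\<delta> n = \<bar>t n\<bar> * D" "\<kappa> n = (t n)\<^sup>2 * K"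
          using elim(1) by (auto simp: D_def K_def)
        then show ?thesis
          unfolding D_def[symmetric] K_def[symmetric]
          by (simp add: abs_mult power_mult_distrib algebra_simps)
      qed
      finally show ?case .
    qed
    have "?U \<longlonglongrightarrow> A * 0 + \<bar>B\<bar> * 0 + \<bar>B\<bar> * 0 * L2_norm (R 0) h + C / 2 * 0 + C * 0\<^sup>2 + 2 * C * 0"
      by (intro tendsto_intros A B C J d1 d2) auto
    then show "?U \<longlonglongrightarrow> 0" by simp
  qed
  moreover have "(\<lambda>n. of_nat (m n) * ?c n) \<longlonglongrightarrow>
      \<i> * (B * (\<integral>x. g x * h x \<partial>R 0)) - A / 2 * (\<integral>x. (h x)\<^sup>2 \<partial>R 0)"
  proof -
    have "(\<lambda>n. \<i> * complex_of_real (m n * (t n * b n) * (\<integral>x. g x * h x \<partial>R 0))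
        - complex_of_real (m n * (b n)\<^sup>2 / 2 * (\<integral>x. (h x)\<^sup>2 \<partial>R 0)))
        \<longlonglongrightarrow> \<i> * complex_of_real (B * (\<integral>x. g x * h x \<partial>R 0))
          - complex_of_real (A / 2 * (\<integral>x. (h x)\<^sup>2 \<partial>R 0))"
      by (intro tendsto_intros A B) auto
    then show ?thesis by (simp add: algebra_simps)
  qed
  ultimately have "(\<lambda>n. (of_nat (m n) * ?E n - of_nat (m n) * ?c n) + of_nat (m n) * ?c n) \<longlonglongrightarrow>
      0 + (\<i> * (B * (\<integral>x. g x * h x \<partial>R 0)) - A / 2 * (\<integral>x. (h x)\<^sup>2 \<partial>R 0))"
    by (rule tendsto_add)
  then show ?thesis by (simp add: algebra_simps)
qed

section \<open>Characteristic function of the test statistic\<close>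

lemma integral_pair_mult:
  fixes f :: "'a \<Rightarrow> complex" and g :: "'b \<Rightarrow> complex"
  assumes M: "prob_space M" and N: "prob_space N"
    and f[measurable]: "f \<in> borel_measurable M" and f1: "\<And>x. cmod (f x) \<le> 1"
    and g[measurable]: "g \<in> borel_measurable N" and g1: "\<And>y. cmod (g y) \<le> 1"
  shows "(\<integral>z. f (fst z) * g (snd z) \<partial>(M \<Otimes>\<^sub>M N)) = (\<integral>x. f x \<partial>M) * (\<integral>y. g y \<partial>N)"
proof -
  interpret M: prob_space M by fact
  interpret N: prob_space N by fact
  interpret pair_prob_space M N ..
  have "integrable (M \<Otimes>\<^sub>M N) (\<lambda>z. f (fst z) * g (snd z))"
    using mult_mono[OF f1 g1] by (intro integrable_const_bound[where B=1]) (auto simp: norm_mult)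
  from integral_fst'[OF this] show ?thesis by simp
qed

text \<open>Independence: the exponential of the sum is a product of functions of single
  coordinates, and the coordinates of each sample are identically distributed.\<close>

lemma integral_iexp_test_statistic:
  assumes P: "prob_space P" and Q: "prob_space Q"
    and k1[measurable]: "k1 \<in> borel_measurable P" and k2[measurable]: "k2 \<in> borel_measurable Q"
  shows "(\<integral>\<omega>. iexp (s * test_statistic k1 k2 n m1 m2 \<omega>) \<partial>sample_measure P Q m1 m2)
    = (\<integral>x. iexp (s * (sqrt n / m1) * k1 x) \<partial>P) ^ m1 * (\<integral>y. iexp (s * (sqrt n / m2) * k2 y) \<partial>Q) ^ m2"
proof -
  interpret P: prob_space P by fact
  interpret Q: prob_space Q by fact
  interpret PP: product_prob_space "\<lambda>_::nat. P" by standard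
  interpret QQ: product_prob_space "\<lambda>_::nat. Q" by standard
  let ?f = "\<lambda>x. iexp (s * (sqrt n / m1) * k1 x)" and ?g = "\<lambda>y. iexp (s * (sqrt n / m2) * k2 y)"
  let ?F = "\<lambda>x. \<Prod>i\<in>{1..m1}. ?f (x i)" and ?G = "\<lambda>y. \<Prod>j\<in>{1..m2}. ?g (y j)"
  have split: "iexp (s * test_statistic k1 k2 n m1 m2 \<omega>) = ?F (fst \<omega>) * ?G (snd \<omega>)" for \<omega>
    by (simp add: test_statistic_def case_prod_beta exp_sum[symmetric] exp_add[symmetric]
        sum_distrib_left sum_distrib_right distrib_left mult_ac)
  have "(\<integral>\<omega>. iexp (s * test_statistic k1 k2 n m1 m2 \<omega>) \<partial>sample_measure P Q m1 m2)
      = (\<integral>x. ?F x \<partial>Pi\<^sub>M {1..m1} (\<lambda>_. P)) * (\<integral>y. ?G y \<partial>Pi\<^sub>M {1..m2} (\<lambda>_. Q))"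
    unfolding split sample_measure_def
    by (rule integral_pair_mult)
      (auto intro!: prob_space_PiM P Q simp: prod_norm[symmetric] norm_exp_i_times)
  also have "(\<integral>x. ?F x \<partial>Pi\<^sub>M {1..m1} (\<lambda>_. P)) = (\<Prod>i\<in>{1..m1}. \<integral>x. ?f x \<partial>P)"
    by (rule PP.product_integral_prod) (auto intro!: P.integrable_const_bound[where B=1])
  also have "(\<integral>y. ?G y \<partial>Pi\<^sub>M {1..m2} (\<lambda>_. Q)) = (\<Prod>i\<in>{1..m2}. \<integral>y. ?g y \<partial>Q)"
    by (rule QQ.product_integral_prod) (auto intro!: Q.integrable_const_bound[where B=1])
  finally show ?thesis by simp
qed

text \<open>The scaling \<open>b = s * sqrt n / m\<close> with \<open>m / n\<close> tending to
  \<open>c\<close> gives the limits \<open>s^2 / c\<close> of \<open>m b^2\<close>,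
  \<open>s \<tau>\<close> of \<open>m t b\<close> and \<open>c \<tau>^2\<close> of
  \<open>m t^2\<close>. The real part of the exponent then carries the variance share of one sample
  and the imaginary part its share of the mean.\<close>

lemma char_power_limit:
  fixes R :: "real \<Rightarrow> 'a measure" and h g :: "'a \<Rightarrow> real" and t :: "nat \<Rightarrow> real" and m :: "nat \<Rightarrow> nat"
  assumes diff: "L2_differentiable \<epsilon> R g"
    and R: "\<And>s. \<bar>s\<bar> < \<epsilon> \<Longrightarrow> prob_space (R s) \<and> sets (R s) = sets (R 0)"
    and h: "h \<in> L2_zero (R 0)"
    and t: "filterlim t (at 0) sequentially" and t_eps: "\<And>n. \<bar>t n\<bar> < \<epsilon>"
    and \<tau>: "(\<lambda>n. sqrt n * t n) \<longlonglongrightarrow> \<tau>"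
    and m: "(\<lambda>n. m n / n) \<longlonglongrightarrow> c" and c: "c > 0"
  shows "(\<lambda>n. (\<integral>x. iexp (s * (sqrt n / m n) * h x) \<partial>R (t n)) ^ m n) \<longlonglongrightarrow>
    exp (complex_of_real (- (s\<^sup>2 / 2 * (1 / c * (\<integral>x. (h x)\<^sup>2 \<partial>R 0))))
      + \<i> * (s * (\<tau> * (\<integral>x. g x * h x \<partial>R 0))))"
proof (rule power_tendsto_exp)
  \<comment> \<open>Discards the indices at which \<open>n\<close> or \<open>m n\<close> is 0 and
    the quotients take the default value 0.\<close>
  have ev: "eventually (\<lambda>n. m n > 0 \<and> n > 0) sequentially"
    using order_tendstoD(1)[OF m c] eventually_gt_at_top[of 0]
    by eventually_elim (auto simp: zero_less_divide_iff)
  have nm: "(\<lambda>n. n / m n) \<longlonglongrightarrow> 1 / c"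
    using tendsto_inverse[OF m] c by (simp add: inverse_eq_divide)
  have "filterlim (\<lambda>n. m n / n * real n) at_top sequentially"
    by (rule filterlim_tendsto_pos_mult_at_top[OF m c filterlim_real_sequentially])
  moreover have "eventually (\<lambda>n. m n / n * real n = real (m n)) sequentially"
    using ev by eventually_elim simp
  ultimately have "filterlim (\<lambda>n. real (m n)) at_top sequentially"
    using filterlim_cong[OF refl refl] by fast
  then show "filterlim m at_top sequentially"
    by (simp add: filterlim_sequentially_iff_filterlim_real)
  have sqrt_inf: "filterlim (\<lambda>n. sqrt (real n)) at_top sequentially"
    by (rule filterlim_compose[OF sqrt_at_top filterlim_real_sequentially])
  have b_lim: "(\<lambda>n. s * (n / m n * inverse (sqrt n))) \<longlonglongrightarrow> s * (1 / c * 0)"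
    by (intro tendsto_intros nm tendsto_inverse_0_at_top sqrt_inf)
  have b_eq: "s * (n / m n * inverse (sqrt n)) = s * (sqrt n / m n)" for n
  proof -
    have root: "n * inverse (sqrt n) = sqrt n"
      using real_div_sqrt[of "real n"] by (simp add: divide_inverse)
    have "s * (n / m n * inverse (sqrt n)) = s * (n * inverse (sqrt n) / m n)"
      by simp
    then show ?thesis unfolding root .
  qed
  have b0: "(\<lambda>n. s * (sqrt n / m n)) \<longlonglongrightarrow> 0"
    using b_lim unfolding b_eq by simp
  have "(\<lambda>n. s\<^sup>2 * (n / m n)) \<longlonglongrightarrow> s\<^sup>2 * (1 / c)"
    by (intro tendsto_intros nm)
  then have A: "(\<lambda>n. m n * (s * (sqrt n / m n))\<^sup>2) \<longlonglongrightarrow> s\<^sup>2 * (1 / c)"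
    by (rule Lim_transform_eventually)
      (use ev in \<open>eventually_elim, simp add: field_simps power2_eq_square\<close>)
  have "(\<lambda>n. s * (sqrt n * t n)) \<longlonglongrightarrow> s * \<tau>"
    by (intro tendsto_intros \<tau>)
  then have B: "(\<lambda>n. m n * (t n * (s * (sqrt n / m n)))) \<longlonglongrightarrow> s * \<tau>"
    by (rule Lim_transform_eventually) (use ev in \<open>eventually_elim, simp\<close>)
  have "(\<lambda>n. m n / n * (sqrt n * t n)\<^sup>2) \<longlonglongrightarrow> c * \<tau>\<^sup>2"
    by (intro tendsto_intros \<tau> m)
  then have C: "(\<lambda>n. m n * (t n)\<^sup>2) \<longlonglongrightarrow> c * \<tau>\<^sup>2"
    by (rule Lim_transform_eventually)
      (use ev in \<open>eventually_elim, simp add: power_mult_distrib\<close>)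
  show "(\<lambda>n. of_nat (m n) * ((\<integral>x. iexp (s * (sqrt n / m n) * h x) \<partial>R (t n)) - 1)) \<longlonglongrightarrow>
      complex_of_real (- (s\<^sup>2 / 2 * (1 / c * (\<integral>x. (h x)\<^sup>2 \<partial>R 0))))
      + \<i> * (s * (\<tau> * (\<integral>x. g x * h x \<partial>R 0)))"
    using char_expansion_limit[OF diff R h t b0 A B C] by (simp add: mult_ac)
  \<comment> \<open>The power limit asks for this bound at every index, which is why
    \<open>t n\<close> is assumed to stay inside the interval for all \<open>n\<close>.\<close>
  show "cmod (\<integral>x. iexp (s * (sqrt n / m n) * h x) \<partial>R (t n)) \<le> 1" for n
  proof -
    interpret prob_space "R (t n)" using R[OF t_eps] by blast
    show ?thesis
      by (rule order_trans[OF integral_norm_bound]) (simp add: norm_exp_i_times prob_space)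
  qed
  show "Re (complex_of_real (- (s\<^sup>2 / 2 * (1 / c * (\<integral>x. (h x)\<^sup>2 \<partial>R 0))))
      + \<i> * (s * (\<tau> * (\<integral>x. g x * h x \<partial>R 0)))) \<le> 0"
    using c by simp
qed

section \<open>The standard normal distribution and limits of tail probabilities\<close>

lemma measure_std_normal_singleton: "measure std_normal_distribution {x} = 0"
proof -
  have "emeasure std_normal_distribution {x} = 0"
    by (subst emeasure_density) (auto intro!: nn_integral_null_set simp: null_sets_def)
  then show ?thesis by (simp add: measure_def)
qed

lemma isCont_std_normal_cdf: "isCont std_normal_cdf x"
proof -
  interpret real_distribution std_normal_distribution by (rule real_dist_normal_dist)
  show ?thesis unfolding std_normal_cdf_def isCont_cdf by (rule measure_std_normal_singleton)
qed

text \<open>The characteristic function of the standard normal law is even, so the reflected law is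
  the same law; continuity at \<open>x\<close> removes the difference between open and closed
  half-lines.\<close>

lemma std_normal_cdf_minus: "std_normal_cdf (- x) = 1 - std_normal_cdf x"
proof -
  interpret real_distribution std_normal_distribution by (rule real_dist_normal_dist)
  let ?N = "distr std_normal_distribution borel uminus"
  have "?N = std_normal_distribution"
  proof (rule Levy_uniqueness)
    show "real_distribution ?N" by (rule real_distribution_distr) simp
    have "char ?N t = char std_normal_distribution (- t)" for t
      by (simp add: char_def integral_distr)
    then show "char ?N = char std_normal_distribution"
      by (simp add: fun_eq_iff char_std_normal_distribution)
  qed (rule real_dist_normal_dist)
  then have "std_normal_cdf (- x) = measure ?N {..-x}"
    by (simp add: std_normal_cdf_def cdf_def)
  also have "\<dots> = prob (uminus -` {..-x} \<inter> space std_normal_distribution)"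
    by (rule measure_distr) auto
  also have "uminus -` {..-x} \<inter> space std_normal_distribution = space std_normal_distribution - {..<x}"
    by auto
  also have "prob \<dots> = 1 - prob {..<x}"
    by (rule prob_compl) simp
  also have "prob {..<x} = prob ({..<x} \<union> {x})"
    by (subst finite_measure_Union) (auto simp: measure_std_normal_singleton)
  also have "{..<x} \<union> {x} = {..x}" by auto
  finally show ?thesis by (simp add: std_normal_cdf_def cdf_def)
qed

lemma mono_std_normal_cdf: "mono std_normal_cdf"
proof -
  interpret real_distribution std_normal_distribution by (rule real_dist_normal_dist)
  show ?thesis unfolding std_normal_cdf_def by (intro monoI cdf_nondecreasing)
qed

text \<open>Since \<open>inv\<close> selects some preimage, it is enough that \<open>p\<close> is
  attained. The limits of the distribution function at both ends and the intermediate value theorem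
  show this.\<close>

lemma std_normal_cdf_quantile:
  assumes "0 < p" "p < 1"
  shows "std_normal_cdf (std_normal_quantile p) = p"
proof -
  interpret real_distribution std_normal_distribution by (rule real_dist_normal_dist)
  obtain a where a: "std_normal_cdf a < p"
    using order_tendstoD(2)[OF cdf_lim_at_bot assms(1)] unfolding std_normal_cdf_def
    by (metis eventually_at_bot_linorder order_refl)
  obtain b where b: "p < std_normal_cdf b"
    using order_tendstoD(1)[OF cdf_lim_at_top_prob assms(2)] unfolding std_normal_cdf_def
    by (metis eventually_at_top_linorder order_refl)
  have "a \<le> b"
    using a b monoD[OF mono_std_normal_cdf, of b a] by linarith
  then have "\<exists>x. a \<le> x \<and> x \<le> b \<and> std_normal_cdf x = p"
    using a b isCont_std_normal_cdf by (intro IVT) auto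
  then show ?thesis
    unfolding std_normal_quantile_def by (metis f_inv_into_f rangeI)
qed

text \<open>Standardizing and applying Levy's theorem gives weak convergence to the standard normal
  law, hence convergence of distribution functions everywhere. Symmetry turns
  \<open>1 - std_normal_cdf (u - \<mu> / \<sigma>)\<close> into the stated limit.\<close>

lemma upper_tail_limit:
  fixes M :: "nat \<Rightarrow> 'a measure" and X :: "nat \<Rightarrow> 'a \<Rightarrow> real"
  assumes M: "\<And>n. prob_space (M n)" and X: "\<And>n. X n \<in> borel_measurable (M n)"
    and \<sigma>: "\<sigma> > 0"
    and lim: "\<And>s. (\<lambda>n. \<integral>\<omega>. iexp (s * X n \<omega>) \<partial>M n) \<longlonglongrightarrow>
      exp (complex_of_real (- (s\<^sup>2 / 2 * \<sigma>\<^sup>2)) + \<i> * (s * \<mu>))"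
  shows "(\<lambda>n. measure (M n) {\<omega> \<in> space (M n). X n \<omega> > u * \<sigma>}) \<longlonglongrightarrow> std_normal_cdf (\<mu> / \<sigma> - u)"
proof -
  define Y where "Y n \<omega> = (X n \<omega> - \<mu>) / \<sigma>" for n \<omega>
  have Y[measurable]: "Y n \<in> borel_measurable (M n)" for n
    unfolding Y_def[abs_def] using X[of n] by measurable
  define N where "N n = distr (M n) borel (Y n)" for n
  have N: "real_distribution (N n)" for n
    unfolding N_def by (rule prob_space.real_distribution_distr[OF M Y])
  have "weak_conv_m N std_normal_distribution"
  proof (rule levy_continuity[OF N real_dist_normal_dist])
    fix s
    have char_N: "char (N n) s = exp (\<i> * complex_of_real (- (s / \<sigma> * \<mu>))) * (\<integral>\<omega>. iexp (s / \<sigma> * X n \<omega>) \<partial>M n)" for n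
    proof -
      have "char (N n) s = (\<integral>\<omega>. iexp (s * Y n \<omega>) \<partial>M n)"
        by (simp add: char_def N_def integral_distr)
      also have "\<dots> = (\<integral>\<omega>. exp (\<i> * complex_of_real (- (s / \<sigma> * \<mu>))) * iexp (s / \<sigma> * X n \<omega>) \<partial>M n)"
        by (intro Bochner_Integration.integral_cong refl)
          (simp add: Y_def exp_add[symmetric] diff_divide_distrib algebra_simps)
      finally show ?thesis by simp
    qed
    \<comment> \<open>The assumption is used at the argument \<open>s / \<sigma>\<close>; the phase
      factor in front cancels the mean.\<close>
    have lim_N: "(\<lambda>n. exp (\<i> * complex_of_real (- (s / \<sigma> * \<mu>))) * (\<integral>\<omega>. iexp (s / \<sigma> * X n \<omega>) \<partial>M n)) \<longlonglongrightarrow>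
        exp (\<i> * complex_of_real (- (s / \<sigma> * \<mu>))) *
        exp (complex_of_real (- ((s / \<sigma>)\<^sup>2 / 2 * \<sigma>\<^sup>2)) + \<i> * (s / \<sigma> * \<mu>))"
      by (intro tendsto_mult tendsto_const lim)
    have char_std: "exp (\<i> * complex_of_real (- (s / \<sigma> * \<mu>))) *
        exp (complex_of_real (- ((s / \<sigma>)\<^sup>2 / 2 * \<sigma>\<^sup>2)) + \<i> * (s / \<sigma> * \<mu>)) = char std_normal_distribution s"
      using \<sigma> by (simp add: char_std_normal_distribution exp_add[symmetric] exp_of_real[symmetric] power_divide)
    show "(\<lambda>n. char (N n) s) \<longlonglongrightarrow> char std_normal_distribution s"
      using lim_N unfolding char_N char_std .
  qed
  then have "(\<lambda>n. cdf (N n) (u - \<mu> / \<sigma>)) \<longlonglongrightarrow> std_normal_cdf (u - \<mu> / \<sigma>)"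
    using isCont_std_normal_cdf[of "u - \<mu> / \<sigma>"]
    by (simp add: weak_conv_m_def weak_conv_def std_normal_cdf_def)
  from tendsto_diff[OF tendsto_const[of 1] this]
  have "(\<lambda>n. 1 - cdf (N n) (u - \<mu> / \<sigma>)) \<longlonglongrightarrow> std_normal_cdf (\<mu> / \<sigma> - u)"
    using std_normal_cdf_minus[of "u - \<mu> / \<sigma>"] by simp
  moreover have "measure (M n) {\<omega> \<in> space (M n). X n \<omega> > u * \<sigma>} = 1 - cdf (N n) (u - \<mu> / \<sigma>)" for n
  proof -
    interpret prob_space "M n" by (rule M)
    let ?A = "Y n -` {..u - \<mu> / \<sigma>} \<inter> space (M n)"
    have "cdf (N n) (u - \<mu> / \<sigma>) = prob ?A"
      unfolding cdf_def N_def by (rule measure_distr) auto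
    moreover have "{\<omega> \<in> space (M n). X n \<omega> > u * \<sigma>} = space (M n) - ?A"
      using \<sigma> by (auto simp: Y_def field_simps)
    ultimately show ?thesis
      by (simp add: prob_compl)
  qed
  ultimately show ?thesis by simp
qed

section \<open>Limits of the power function\<close>

lemma distr_pair_snd:
  assumes "prob_space M" "prob_space N"
  shows "distr (M \<Otimes>\<^sub>M N) N snd = N"
proof (rule measure_eqI)
  interpret M: prob_space M by fact
  interpret N: prob_space N by fact
  fix A assume "A \<in> sets (distr (M \<Otimes>\<^sub>M N) N snd)"
  then have A: "A \<in> sets N" by simp
  then have "snd -` A \<inter> space (M \<Otimes>\<^sub>M N) = space M \<times> A"
    by (auto simp: space_pair_measure dest: sets.sets_into_space)
  with A show "emeasure (distr (M \<Otimes>\<^sub>M N) N snd) A = emeasure N A"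
    by (simp add: emeasure_distr N.emeasure_pair_measure_Times M.emeasure_space_1)
qed simp

lemma integral_pair_fst:
  fixes f :: "'a \<Rightarrow> 'c::{banach, second_countable_topology}"
  assumes "prob_space N" "f \<in> borel_measurable M"
  shows "(\<integral>z. f (fst z) \<partial>(M \<Otimes>\<^sub>M N)) = (\<integral>x. f x \<partial>M)"
  using integral_distr[of fst "M \<Otimes>\<^sub>M N" M f] assms
  by (simp add: prob_space.distr_pair_fst)

lemma integral_pair_snd:
  fixes f :: "'b \<Rightarrow> 'c::{banach, second_countable_topology}"
  assumes "prob_space M" "prob_space N" "f \<in> borel_measurable N"
  shows "(\<integral>z. f (snd z) \<partial>(M \<Otimes>\<^sub>M N)) = (\<integral>y. f y \<partial>N)"
  using integral_distr[of snd "M \<Otimes>\<^sub>M N" N f] assms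
  by (simp add: distr_pair_snd)

lemma L2_zero_fst:
  assumes "prob_space N" "h \<in> L2_zero M"
  shows "(\<lambda>z. h (fst z)) \<in> L2_zero (M \<Otimes>\<^sub>M N)"
proof -
  have [measurable]: "h \<in> borel_measurable M" and h: "integrable M (\<lambda>x. (h x)\<^sup>2)" "(\<integral>x. h x \<partial>M) = 0"
    using assms by (auto simp: L2_zero_def L2_def)
  have "integrable (distr (M \<Otimes>\<^sub>M N) M fst) (\<lambda>x. (h x)\<^sup>2)"
    using h assms by (simp add: prob_space.distr_pair_fst)
  then have "integrable (M \<Otimes>\<^sub>M N) (\<lambda>z. (h (fst z))\<^sup>2)"
    by (subst (asm) integrable_distr_eq) auto
  then show ?thesis
    using h assms by (simp add: L2_zero_def L2_def integral_pair_fst)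
qed

lemma L2_zero_snd:
  assumes "prob_space M" "prob_space N" "h \<in> L2_zero N"
  shows "(\<lambda>z. h (snd z)) \<in> L2_zero (M \<Otimes>\<^sub>M N)"
proof -
  have [measurable]: "h \<in> borel_measurable N" and h: "integrable N (\<lambda>x. (h x)\<^sup>2)" "(\<integral>x. h x \<partial>N) = 0"
    using assms by (auto simp: L2_zero_def L2_def)
  have "integrable (distr (M \<Otimes>\<^sub>M N) N snd) (\<lambda>x. (h x)\<^sup>2)"
    using h assms by (simp add: distr_pair_snd)
  then have "integrable (M \<Otimes>\<^sub>M N) (\<lambda>z. (h (snd z))\<^sup>2)"
    by (subst (asm) integrable_distr_eq) auto
  then show ?thesis
    using h assms by (simp add: L2_zero_def L2_def integral_pair_snd)
qed

lemma measurable_test_statistic: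
  assumes [measurable]: "k1 \<in> borel_measurable P" "k2 \<in> borel_measurable Q"
  shows "test_statistic k1 k2 n m1 m2 \<in> borel_measurable (sample_measure P Q m1 m2)"
  unfolding test_statistic_def sample_measure_def by measurable

text \<open>Makes the null hypothesis an instance of the limit along curves: the constant curve has
  density quotient 1 and tangent 0.\<close>

lemma L2_differentiable_const:
  assumes "prob_space M"
  shows "L2_differentiable 1 (\<lambda>_. M) (\<lambda>_. 0)"
proof -
  interpret prob_space M by fact
  have "density_quotient M M (\<lambda>_. 1)"
    by (auto simp: density_quotient_def emeasure_space_1)
  then show ?thesis
    unfolding L2_differentiable_def
    by (intro conjI exI[of _ "\<lambda>_ _. 1"]) (auto simp: L2_def L2_norm_def)
qed

text \<open>The two sample factors of the characteristic function have limits whose product belongs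
  to a normal law with variance \<open>asymp_variance\<close> and mean \<open>\<tau>\<close> times
  the inner product of the gradient with \<open>g\<close>. The curve is kept general so that the
  constant curve is covered as well.\<close>

lemma power_function_limit:
  fixes P :: "real \<Rightarrow> 'a measure" and Q :: "real \<Rightarrow> 'b measure"
    and g :: "'a \<times> 'b \<Rightarrow> real" and t :: "nat \<Rightarrow> real" and n1 n2 :: "nat \<Rightarrow> nat"
  assumes diff: "L2_differentiable \<epsilon> (\<lambda>s. P s \<Otimes>\<^sub>M Q s) g"
    and P: "\<And>s. \<bar>s\<bar> < \<epsilon> \<Longrightarrow> P s \<in> space (prob_algebra A1)"
    and Q: "\<And>s. \<bar>s\<bar> < \<epsilon> \<Longrightarrow> Q s \<in> space (prob_algebra A2)"
    and k1: "k1 \<in> L2_zero (P 0)" and k2: "k2 \<in> L2_zero (Q 0)"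
    and n12: "\<And>n. n1 n + n2 n = n"
    and d: "(\<lambda>n. n2 n / n) \<longlonglongrightarrow> d" "0 < d" "d < 1"
    and t: "filterlim t (at 0) sequentially"
    and \<tau>: "(\<lambda>n. sqrt n * t n) \<longlonglongrightarrow> \<tau>"
    and V: "asymp_variance (P 0) (Q 0) k1 k2 d > 0"
  shows "(\<lambda>n. \<integral>\<omega>. (if test_statistic k1 k2 n (n1 n) (n2 n) \<omega> > u * sqrt (asymp_variance (P 0) (Q 0) k1 k2 d)
      then 1 else 0 :: real) \<partial>sample_measure (P (t n)) (Q (t n)) (n1 n) (n2 n))
    \<longlonglongrightarrow> std_normal_cdf (\<tau> * (\<integral>z. (k1 (fst z) + k2 (snd z)) * g z \<partial>(P 0 \<Otimes>\<^sub>M Q 0))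
        / sqrt (asymp_variance (P 0) (Q 0) k1 k2 d) - u)"
proof -
  define \<sigma> where "\<sigma> = sqrt (asymp_variance (P 0) (Q 0) k1 k2 d)"
  let ?R = "\<lambda>s. P s \<Otimes>\<^sub>M Q s"
  let ?T = "\<lambda>n. test_statistic k1 k2 n (n1 n) (n2 n)"
  have \<epsilon>: "\<epsilon> > 0" and g: "g \<in> L2 (?R 0)"
    using diff unfolding L2_differentiable_def by auto
  have probP: "prob_space (P s)" and setsP: "sets (P s) = sets A1" if "\<bar>s\<bar> < \<epsilon>" for s
    using P[OF that] by (auto simp: space_prob_algebra)
  have probQ: "prob_space (Q s)" and setsQ: "sets (Q s) = sets A2" if "\<bar>s\<bar> < \<epsilon>" for s
    using Q[OF that] by (auto simp: space_prob_algebra)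
  have P0: "prob_space (P 0)" "sets (P 0) = sets A1" and Q0: "prob_space (Q 0)" "sets (Q 0) = sets A2"
    using probP probQ setsP setsQ \<epsilon> by auto
  \<comment> \<open>Outside the interval from \<open>- \<epsilon>\<close> to \<open>\<epsilon>\<close> the curve need not consist of probability measures.\<close>
  define t' where "t' n = (if \<bar>t n\<bar> < \<epsilon> then t n else \<epsilon> / 2)" for n
  have t'_eps: "\<bar>t' n\<bar> < \<epsilon>" for n
    using \<epsilon> by (simp add: t'_def)
  have "t \<longlonglongrightarrow> 0"
    using t by (simp add: filterlim_at)
  then have "eventually (\<lambda>n. \<bar>t n\<bar> < \<epsilon>) sequentially"
    using order_tendstoD(2)[OF tendsto_rabs, of t 0 sequentially \<epsilon>] \<epsilon> by simp
  then have t'_eq: "eventually (\<lambda>n. t' n = t n) sequentially"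
    by eventually_elim (simp add: t'_def)
  have t': "filterlim t' (at 0) sequentially"
    using filterlim_cong[OF refl refl t'_eq] t by blast
  have \<tau>': "(\<lambda>n. sqrt n * t' n) \<longlonglongrightarrow> \<tau>"
    by (rule Lim_transform_eventually[OF \<tau>]) (use t'_eq in \<open>eventually_elim, simp\<close>)
  have R: "prob_space (?R s) \<and> sets (?R s) = sets (?R 0)" if "\<bar>s\<bar> < \<epsilon>" for s
    using probP[OF that] probQ[OF that] setsP[OF that] setsQ[OF that] P0 Q0
    by (auto intro!: prob_space_pair sets_pair_measure_cong)
  have k1m: "k1 \<in> borel_measurable (P (t' n))" and k2m: "k2 \<in> borel_measurable (Q (t' n))" for n
    using k1 k2 setsP[OF t'_eps, of n] setsQ[OF t'_eps, of n] P0 Q0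
    by (simp_all add: L2_zero_def L2_def cong: measurable_cong_sets)
  note prob = probP[OF t'_eps] probQ[OF t'_eps]
  \<comment> \<open>Both parts of the gradient are lifted to the product space, because the
    expansion is available only for the product curve.\<close>
  let ?h1 = "\<lambda>z. k1 (fst z) :: real" and ?h2 = "\<lambda>z. k2 (snd z) :: real"
  have h1: "?h1 \<in> L2_zero (?R 0)" and h2: "?h2 \<in> L2_zero (?R 0)"
    using L2_zero_fst[OF Q0(1) k1] L2_zero_snd[OF P0(1) Q0(1) k2] by auto
  have "(\<lambda>n. n1 n / n) \<longlonglongrightarrow> 1 - d"
  proof (rule Lim_transform_eventually)
    show "(\<lambda>n. 1 - n2 n / n) \<longlonglongrightarrow> 1 - d" by (intro tendsto_intros d)
    show "eventually (\<lambda>n. 1 - n2 n / n = n1 n / n) sequentially"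
      using eventually_gt_at_top[of 0]
    proof eventually_elim
      case (elim n)
      have "real n = n1 n + n2 n" using n12[of n] by linarith
      with elim show ?case by (simp add: field_simps)
    qed
  qed
  \<comment> \<open>The limiting sample fractions are \<open>1 - d\<close> and \<open>d\<close>;
    their reciprocals are the weights in \<open>asymp_variance\<close>.\<close>
  note lim1 = char_power_limit[OF diff R h1 t' t'_eps \<tau>' this]
  note lim2 = char_power_limit[OF diff R h2 t' t'_eps \<tau>' d(1,2)]
  have int1: "(\<integral>z. (?h1 z)\<^sup>2 \<partial>?R 0) = (\<integral>x. (k1 x)\<^sup>2 \<partial>P 0)"
    and int2: "(\<integral>z. (?h2 z)\<^sup>2 \<partial>?R 0) = (\<integral>y. (k2 y)\<^sup>2 \<partial>Q 0)"
    using k1 k2 integral_pair_fst[OF Q0(1), of "\<lambda>x. (k1 x)\<^sup>2" "P 0"]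
      integral_pair_snd[OF P0(1) Q0(1), of "\<lambda>y. (k2 y)\<^sup>2"]
    by (auto simp: L2_zero_def L2_def)
  let ?\<mu> = "\<tau> * (\<integral>z. (k1 (fst z) + k2 (snd z)) * g z \<partial>?R 0)"
  have \<mu>: "?\<mu> = \<tau> * (\<integral>z. g z * ?h1 z \<partial>?R 0) + \<tau> * (\<integral>z. g z * ?h2 z \<partial>?R 0)"
    using L2_mult_integrable[of g "?R 0"] g h1 h2
    by (simp add: L2_zero_def distrib_left mult.commute[of _ "g _"])
  have \<sigma>2: "\<sigma>\<^sup>2 = 1 / (1 - d) * (\<integral>x. (k1 x)\<^sup>2 \<partial>P 0) + 1 / d * (\<integral>y. (k2 y)\<^sup>2 \<partial>Q 0)"
    using V by (simp add: \<sigma>_def asymp_variance_def)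
  \<comment> \<open>Leads from the product curve back to the marginals, under which the factors of
    the characteristic function are computed.\<close>
  have fst_int: "(\<integral>z. iexp (c * k1 (fst z)) \<partial>?R (t' n)) = (\<integral>x. iexp (c * k1 x) \<partial>P (t' n))" for c n
    using k1m[of n] by (intro integral_pair_fst prob) measurable
  have snd_int: "(\<integral>z. iexp (c * k2 (snd z)) \<partial>?R (t' n)) = (\<integral>x. iexp (c * k2 x) \<partial>Q (t' n))" for c n
    using k2m[of n] by (intro integral_pair_snd prob) measurable
  have char_lim: "(\<lambda>n. \<integral>\<omega>. iexp (s * ?T n \<omega>) \<partial>sample_measure (P (t' n)) (Q (t' n)) (n1 n) (n2 n)) \<longlonglongrightarrow>
      exp (complex_of_real (- (s\<^sup>2 / 2 * \<sigma>\<^sup>2)) + \<i> * (s * ?\<mu>))" for s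
  proof -
    have "1 - d > 0" using d by simp
    from tendsto_mult[OF lim1[OF _ this, of s] lim2[of s]]
    show ?thesis
      unfolding integral_iexp_test_statistic[OF prob k1m k2m] fst_int snd_int exp_add[symmetric] int1 int2 \<mu> \<sigma>2
      by (simp add: algebra_simps)
  qed
  have prob_sample: "prob_space (sample_measure (P (t' n)) (Q (t' n)) (n1 n) (n2 n))" for n
    unfolding sample_measure_def by (intro prob_space_pair prob_space_PiM prob)
  note meas = measurable_test_statistic[OF k1m k2m]
  have "(\<lambda>n. measure (sample_measure (P (t' n)) (Q (t' n)) (n1 n) (n2 n))
      {\<omega> \<in> space (sample_measure (P (t' n)) (Q (t' n)) (n1 n) (n2 n)). ?T n \<omega> > u * \<sigma>})
      \<longlonglongrightarrow> std_normal_cdf (?\<mu> / \<sigma> - u)"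
    using V by (intro upper_tail_limit prob_sample meas char_lim) (simp add: \<sigma>_def)
  moreover have "measure M {\<omega> \<in> space M. X \<omega> > c} = (\<integral>\<omega>. (if X \<omega> > c then 1 else 0) \<partial>M)"
    if X[measurable]: "X \<in> borel_measurable M" for M :: "'c measure" and X :: "'c \<Rightarrow> real" and c
  proof -
    have "(\<integral>\<omega>. (if X \<omega> > c then 1 else 0) \<partial>M) = (\<integral>\<omega>. indicat_real {\<omega> \<in> space M. X \<omega> > c} \<omega> \<partial>M)"
      by (intro Bochner_Integration.integral_cong) auto
    also have "\<dots> = measure M {\<omega> \<in> space M. X \<omega> > c}" by simp
    finally show ?thesis by simp
  qed
  note this[OF meas]
  ultimately have "(\<lambda>n. \<integral>\<omega>. (if ?T n \<omega> > u * \<sigma> then 1 else 0 :: real)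
      \<partial>sample_measure (P (t' n)) (Q (t' n)) (n1 n) (n2 n)) \<longlonglongrightarrow> std_normal_cdf (?\<mu> / \<sigma> - u)"
    by simp
  then show ?thesis
    unfolding \<sigma>_def[symmetric]
    by (rule Lim_transform_eventually) (use t'_eq in \<open>eventually_elim, simp\<close>)
qed

section \<open>Two-sided derivatives of the functional\<close>

text \<open>Substituting \<open>-s\<close> for \<open>s\<close> preserves both rates
  \<open>|s|\<close> and \<open>s^2\<close>, and the sign moves from the parameter to the
  tangent.\<close>

lemma differentiable_curve_reverse:
  assumes "differentiable_curve F \<epsilon> R g"
  shows "differentiable_curve F \<epsilon> (\<lambda>s. R (- s)) (\<lambda>x. - g x)"
proof -
  obtain L where \<epsilon>: "\<epsilon> > 0" and F: "\<And>s. \<bar>s\<bar> < \<epsilon> \<Longrightarrow> R s \<in> F" and g: "g \<in> L2 (R 0)"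
    and L: "\<And>s. \<bar>s\<bar> < \<epsilon> \<Longrightarrow> density_quotient (R s) (R 0) (L s)"
    and o1: "(\<lambda>s. L2_norm (R 0) (\<lambda>x. 2 * (sqrt (enn2real (L s x)) - 1) - s * g x)) \<in> o[at 0](\<lambda>s. \<bar>s\<bar>)"
    and o2: "(\<lambda>s. measure (R s) {x \<in> space (R s). L s x = \<infinity>}) \<in> o[at 0](\<lambda>s. s\<^sup>2)"
    using assms unfolding differentiable_curve_def L2_differentiable_def by blast
  have minus: "filterlim uminus (at (0::real)) (at 0)"
    using filtermap_at_minus[of "0::real"] by (simp add: filterlim_def)
  have "L2_differentiable \<epsilon> (\<lambda>s. R (- s)) (\<lambda>x. - g x)"
    unfolding L2_differentiable_def
    using \<epsilon> L L2_cmult[OF g, of "-1"] landau_o.small.compose[OF o1 minus] landau_o.small.compose[OF o2 minus]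
    by (intro conjI exI[of _ "\<lambda>s. L (- s)"]) auto
  then show ?thesis
    using F by (simp add: differentiable_curve_def)
qed

text \<open>A gradient prescribes only limits from the right. The limit from the left is the limit
  from the right along the reversed curve, where the sign of the tangent and that of the difference
  quotient cancel.\<close>

lemma gradient_tendsto_at:
  assumes grad: "gradient F k M kd" and curve: "differentiable_curve F \<epsilon> R g" and R0: "R 0 = M"
  shows "((\<lambda>s. (k (R s) - k M) / s) \<longlongrightarrow> (\<integral>x. kd x * g x \<partial>M)) (at 0)"
  unfolding filterlim_at_split
proof
  show "((\<lambda>s. (k (R s) - k M) / s) \<longlongrightarrow> (\<integral>x. kd x * g x \<partial>M)) (at_right 0)"
    using grad curve R0 unfolding gradient_def by blast
  have "((\<lambda>s. (k (R (- s)) - k M) / s) \<longlongrightarrow> (\<integral>x. kd x * - g x \<partial>M)) (at_right 0)"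
    using grad differentiable_curve_reverse[OF curve] R0 unfolding gradient_def by force
  from tendsto_minus[OF this]
  show "((\<lambda>s. (k (R s) - k M) / s) \<longlongrightarrow> (\<integral>x. kd x * g x \<partial>M)) (at_left 0)"
    by (simp add: filterlim_at_left_to_right)
qed

text \<open>From \<open>(a + b)^2 \<le> 2 a^2 + 2 b^2\<close> the second moment of \<open>kt\<close>
  is at most twice the sum of those of \<open>k1\<close> and \<open>k2\<close>. One of these is
  therefore positive, and it enters the variance with positive weight.\<close>

lemma asymp_variance_pos:
  assumes P: "prob_space P" and Q: "prob_space Q" and k1: "k1 \<in> L2_zero P" and k2: "k2 \<in> L2_zero Q"
    and kt: "kt \<in> L2 (P \<Otimes>\<^sub>M Q)"
    and eq: "AE z in P \<Otimes>\<^sub>M Q. kt z = k1 (fst z) + k2 (snd z)"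
    and ne: "(\<integral>z. (kt z)\<^sup>2 \<partial>(P \<Otimes>\<^sub>M Q)) \<noteq> 0"
    and d: "0 < d" "d < 1"
  shows "asymp_variance P Q k1 k2 d > 0"
proof -
  let ?a = "\<integral>x. (k1 x)\<^sup>2 \<partial>P" and ?b = "\<integral>y. (k2 y)\<^sup>2 \<partial>Q"
  have h1: "(\<lambda>z. k1 (fst z)) \<in> L2 (P \<Otimes>\<^sub>M Q)" and h2: "(\<lambda>z. k2 (snd z)) \<in> L2 (P \<Otimes>\<^sub>M Q)"
    using L2_zero_fst[OF Q k1] L2_zero_snd[OF P Q k2] by (auto simp: L2_zero_def)
  have "(\<integral>z. (kt z)\<^sup>2 \<partial>(P \<Otimes>\<^sub>M Q)) \<le> (\<integral>z. 2 * (k1 (fst z))\<^sup>2 + 2 * (k2 (snd z))\<^sup>2 \<partial>(P \<Otimes>\<^sub>M Q))"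
  proof (rule integral_mono_AE)
    show "integrable (P \<Otimes>\<^sub>M Q) (\<lambda>z. (kt z)\<^sup>2)" using kt by (simp add: L2_def)
    show "integrable (P \<Otimes>\<^sub>M Q) (\<lambda>z. 2 * (k1 (fst z))\<^sup>2 + 2 * (k2 (snd z))\<^sup>2)"
      using h1 h2 by (simp add: L2_def)
    show "AE z in P \<Otimes>\<^sub>M Q. (kt z)\<^sup>2 \<le> 2 * (k1 (fst z))\<^sup>2 + 2 * (k2 (snd z))\<^sup>2"
      using eq
    proof eventually_elim
      case (elim z)
      then show ?case
        using sum_squares_bound[of "k1 (fst z)" "k2 (snd z)"] by (simp add: power2_sum)
    qed
  qed
  also have "\<dots> = 2 * ?a + 2 * ?b"
    using h1 h2 k1 k2 integral_pair_fst[OF Q, of "\<lambda>x. (k1 x)\<^sup>2" P]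
      integral_pair_snd[OF P Q, of "\<lambda>y. (k2 y)\<^sup>2"]
    by (auto simp: L2_def L2_zero_def)
  finally have "(\<integral>z. (kt z)\<^sup>2 \<partial>(P \<Otimes>\<^sub>M Q)) \<le> 2 * ?a + 2 * ?b" .
  moreover have "(\<integral>z. (kt z)\<^sup>2 \<partial>(P \<Otimes>\<^sub>M Q)) > 0"
    using ne by (simp add: order_less_le)
  moreover have ab: "?a \<ge> 0" "?b \<ge> 0" by simp_all
  ultimately have "?a > 0 \<or> ?b > 0" by linarith
  then show ?thesis
  proof
    assume "?a > 0"
    then have "?a / (1 - d) > 0" "?b / d \<ge> 0" using d ab by auto
    then show ?thesis by (simp add: asymp_variance_def)
  next
    assume "?b > 0"
    then have "?a / (1 - d) \<ge> 0" "?b / d > 0" using d ab by auto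
    then show ?thesis by (simp add: asymp_variance_def)
  qed
qed

theorem mainTheorem5:
  fixes A1 :: "'a measure" and A2 :: "'b measure"
    and \<P> :: "'a measure set" and \<Q> :: "'b measure set"
    and k :: "('a \<times> 'b) measure \<Rightarrow> real"
    and P0 :: "'a measure" and Q0 :: "'b measure"
    and kt :: "'a \<times> 'b \<Rightarrow> real" and k1 :: "'a \<Rightarrow> real" and k2 :: "'b \<Rightarrow> real"
    and \<alpha> d \<epsilon> \<theta> :: real
    and n1 n2 :: "nat \<Rightarrow> nat"
    and P :: "real \<Rightarrow> 'a measure" and Q :: "real \<Rightarrow> 'b measure"
    and g :: "'a \<times> 'b \<Rightarrow> real"
    and t :: "nat \<Rightarrow> real"
    and \<psi> :: "nat \<Rightarrow> (nat \<Rightarrow> 'a) \<times> (nat \<Rightarrow> 'b) \<Rightarrow> real"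
  assumes "\<P> \<subseteq> space (prob_algebra A1)" and "\<Q> \<subseteq> space (prob_algebra A2)"
    and "P0 \<in> \<P>" and "Q0 \<in> \<Q>"
    and "canonical_gradient (product_family \<P> \<Q>) k (P0 \<Otimes>\<^sub>M Q0) kt"
    and "k1 \<in> L2_zero P0" and "k2 \<in> L2_zero Q0"
    and "AE z in P0 \<Otimes>\<^sub>M Q0. kt z = k1 (fst z) + k2 (snd z)"
    and "0 < \<alpha>" and "\<alpha> < 1"
    and "\<And>n. n1 n + n2 n = n"
    and "(\<lambda>n. real (n2 n) / real n) \<longlonglongrightarrow> d" and "0 < d" and "d < 1"
    and "\<And>s. \<bar>s\<bar> < \<epsilon> \<Longrightarrow> P s \<in> \<P>" and "\<And>s. \<bar>s\<bar> < \<epsilon> \<Longrightarrow> Q s \<in> \<Q>"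
    and "P 0 = P0" and "Q 0 = Q0"
    and "L2_differentiable \<epsilon> (\<lambda>s. P s \<Otimes>\<^sub>M Q s) g"
    and "g \<in> L2_zero (P0 \<Otimes>\<^sub>M Q0)"
    and "(\<integral>z. (kt z)\<^sup>2 \<partial>(P0 \<Otimes>\<^sub>M Q0)) \<noteq> 0"
    and "(\<integral>z. kt z * g z \<partial>(P0 \<Otimes>\<^sub>M Q0)) \<noteq> 0"
    and "t \<longlonglongrightarrow> 0"
    and "\<theta> \<noteq> 0"
    and "(\<lambda>n. k (P (t n) \<Otimes>\<^sub>M Q (t n)) - (k (P0 \<Otimes>\<^sub>M Q0) + real n powr (-1/2) * \<theta>))
           \<in> o(\<lambda>n. real n powr (-1/2))"
    and "\<And>n \<omega>. \<psi> n \<omega> =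
           (if test_statistic k1 k2 n (n1 n) (n2 n) \<omega> > critical_value \<alpha> P0 Q0 k1 k2 d
            then 1 else 0)"
  shows "((\<lambda>n. \<integral>\<omega>. \<psi> n \<omega> \<partial>(sample_measure P0 Q0 (n1 n) (n2 n))) \<longlonglongrightarrow> \<alpha>) \<and>
    ((\<lambda>n. \<integral>\<omega>. \<psi> n \<omega> \<partial>(sample_measure (P (t n)) (Q (t n)) (n1 n) (n2 n)))
       \<longlonglongrightarrow> std_normal_cdf (\<theta> * (asymp_variance P0 Q0 k1 k2 d) powr (-1/2)
                           - std_normal_quantile (1 - \<alpha>))) \<and>
    (\<theta> < 0 \<longrightarrow>
       std_normal_cdf (\<theta> * (asymp_variance P0 Q0 k1 k2 d) powr (-1/2)
                       - std_normal_quantile (1 - \<alpha>)) \<le> \<alpha>)"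
proof -
  note subP = assms(1) and subQ = assms(2) and cgrad = assms(5)
    and k1 = assms(6) and k2 = assms(7) and kt_eq = assms(8) and \<alpha> = assms(9,10) and n12 = assms(11)
    and d = assms(12-14) and curveP = assms(15) and curveQ = assms(16) and PQ0 = assms(17,18)
    and diff = assms(19) and g = assms(20) and kt_ne = assms(21) and G_ne = assms(22)
    and \<theta> = assms(24) and expansion = assms(25) and \<psi> = assms(26)
  let ?M = "P0 \<Otimes>\<^sub>M Q0"
  define V where "V = asymp_variance P0 Q0 k1 k2 d"
  define u where "u = std_normal_quantile (1 - \<alpha>)"
  define G where "G = (\<integral>z. kt z * g z \<partial>?M)"
  have P0: "P0 \<in> space (prob_algebra A1)" "prob_space P0"
    and Q0: "Q0 \<in> space (prob_algebra A2)" "prob_space Q0"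
    using assms(1-4) by (auto simp: space_prob_algebra)
  have grad: "gradient (product_family \<P> \<Q>) k ?M kt" and kt: "kt \<in> L2 ?M"
    using cgrad by (auto simp: canonical_gradient_def gradient_def L2_zero_def)
  have V: "V > 0"
    unfolding V_def by (rule asymp_variance_pos[OF P0(2) Q0(2) k1 k2 kt kt_eq kt_ne d(2,3)])
  have curve: "differentiable_curve (product_family \<P> \<Q>) \<epsilon> (\<lambda>s. P s \<Otimes>\<^sub>M Q s) g"
    using curveP curveQ diff unfolding differentiable_curve_def product_family_def by blast
  have deriv: "((\<lambda>s. (k (P s \<Otimes>\<^sub>M Q s) - k ?M) / s) \<longlongrightarrow> G) (at 0)"
    unfolding G_def using gradient_tendsto_at[OF grad curve] PQ0 by simp
  define D where "D n = k (P (t n) \<Otimes>\<^sub>M Q (t n)) - k ?M" for n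
  have D_lim: "(\<lambda>n. sqrt n * D n) \<longlonglongrightarrow> \<theta>"
  proof -
    have "(\<lambda>n. (D n - real n powr (-1/2) * \<theta>) / real n powr (-1/2)) \<longlonglongrightarrow> 0"
      using smalloD_tendsto[OF expansion] by (simp add: D_def algebra_simps)
    moreover have "eventually (\<lambda>n. (D n - real n powr (-1/2) * \<theta>) / real n powr (-1/2) = sqrt n * D n - \<theta>) sequentially"
      using eventually_gt_at_top[of 0]
      by eventually_elim (simp add: powr_minus powr_half_sqrt field_simps)
    ultimately have "(\<lambda>n. sqrt n * D n - \<theta>) \<longlonglongrightarrow> 0"
      by (rule Lim_transform_eventually)
    then show ?thesis by (simp add: LIM_zero_iff)
  qed
  \<comment> \<open>As \<open>\<theta>\<close> is nonzero, the increments of \<open>k\<close> are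
    eventually nonzero, and this forces \<open>t n \<noteq> 0\<close>: the increment at parameter 0
    is 0. Hence \<open>t\<close> converges to 0 in the punctured sense needed for difference
    quotients.\<close>
  have D_ne: "eventually (\<lambda>n. D n \<noteq> 0) sequentially"
    using tendsto_imp_eventually_ne[OF D_lim \<theta>] by eventually_elim auto
  then have t_ne: "eventually (\<lambda>n. t n \<noteq> 0) sequentially"
    by eventually_elim (auto simp: D_def PQ0)
  have t: "filterlim t (at 0) sequentially"
    using assms(23) t_ne by (simp add: filterlim_at)
  \<comment> \<open>The scaled increment of \<open>k\<close> tends to \<open>\<theta>\<close> and
    the difference quotient to \<open>G \<noteq> 0\<close>; their quotient is
    \<open>sqrt n * t n\<close>.\<close>
  have \<tau>: "(\<lambda>n. sqrt n * t n) \<longlonglongrightarrow> \<theta> / G"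
  proof (rule Lim_transform_eventually)
    have "(\<lambda>n. D n / t n) \<longlonglongrightarrow> G"
      unfolding D_def by (rule filterlim_compose[OF deriv t])
    then show "(\<lambda>n. sqrt n * D n / (D n / t n)) \<longlonglongrightarrow> \<theta> / G"
      using G_ne by (intro tendsto_divide D_lim) (simp_all add: G_def)
    show "eventually (\<lambda>n. sqrt n * D n / (D n / t n) = sqrt n * t n) sequentially"
      using D_ne by eventually_elim simp
  qed
  have G_eq: "(\<integral>z. (k1 (fst z) + k2 (snd z)) * g z \<partial>?M) = G"
    unfolding G_def
  proof (rule integral_cong_AE)
    have "(\<lambda>z. k1 (fst z)) \<in> L2_zero ?M" "(\<lambda>z. k2 (snd z)) \<in> L2_zero ?M"
      by (rule L2_zero_fst[OF Q0(2) k1] L2_zero_snd[OF P0(2) Q0(2) k2])+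
    then have [measurable]: "(\<lambda>z. k1 (fst z)) \<in> borel_measurable ?M" "(\<lambda>z. k2 (snd z)) \<in> borel_measurable ?M"
      "g \<in> borel_measurable ?M" "kt \<in> borel_measurable ?M"
      using g kt by (simp_all add: L2_zero_def L2_def)
    show "(\<lambda>z. (k1 (fst z) + k2 (snd z)) * g z) \<in> borel_measurable ?M"
      "(\<lambda>z. kt z * g z) \<in> borel_measurable ?M" by measurable
    show "AE z in ?M. (k1 (fst z) + k2 (snd z)) * g z = kt z * g z"
      using kt_eq by eventually_elim simp
  qed
  have \<psi>_eq: "\<psi> n = (\<lambda>\<omega>. if test_statistic k1 k2 n (n1 n) (n2 n) \<omega> > u * sqrt V then 1 else 0)" for n
    by (rule ext) (simp add: \<psi> critical_value_def u_def V_def)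
  \<comment> \<open>The constant curve at \<open>P0\<close> and \<open>Q0\<close> with tangent 0:
    the mean vanishes and the limit is \<open>std_normal_cdf (- u)\<close>.\<close>
  have "(\<lambda>n. \<integral>\<omega>. \<psi> n \<omega> \<partial>sample_measure P0 Q0 (n1 n) (n2 n)) \<longlonglongrightarrow>
      std_normal_cdf (\<theta> / G * (\<integral>z. (k1 (fst z) + k2 (snd z)) * 0 \<partial>?M) / sqrt V - u)"
    unfolding \<psi>_eq V_def
    by (rule power_function_limit[where P="\<lambda>_. P0" and Q="\<lambda>_. Q0" and g="\<lambda>_. 0",
          OF L2_differentiable_const P0(1) Q0(1) k1 k2 n12 d t \<tau> V[unfolded V_def]])
      (rule prob_space_pair[OF P0(2) Q0(2)])
  moreover have null: "std_normal_cdf (- u) = \<alpha>"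
    using std_normal_cdf_minus[of u] std_normal_cdf_quantile[of "1 - \<alpha>"] \<alpha> by (simp add: u_def)
  ultimately have level: "(\<lambda>n. \<integral>\<omega>. \<psi> n \<omega> \<partial>sample_measure P0 Q0 (n1 n) (n2 n)) \<longlonglongrightarrow> \<alpha>"
    by simp
  have P: "P s \<in> space (prob_algebra A1)" and Q: "Q s \<in> space (prob_algebra A2)" if "\<bar>s\<bar> < \<epsilon>" for s
    using curveP[OF that] curveQ[OF that] subP subQ by auto
  have "k1 \<in> L2_zero (P 0)" "k2 \<in> L2_zero (Q 0)" "asymp_variance (P 0) (Q 0) k1 k2 d > 0"
    using k1 k2 V unfolding PQ0 V_def by auto
  \<comment> \<open>Along the given curve the mean is \<open>\<theta> / G\<close> times
    \<open>G\<close>, so the inner product of gradient and tangent cancels and only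
    \<open>\<theta>\<close> remains.\<close>
  from power_function_limit[OF diff P Q this(1,2) n12 d t \<tau> this(3), where u=u]
  have "(\<lambda>n. \<integral>\<omega>. \<psi> n \<omega> \<partial>sample_measure (P (t n)) (Q (t n)) (n1 n) (n2 n)) \<longlonglongrightarrow>
      std_normal_cdf (\<theta> / G * G / sqrt V - u)"
    unfolding PQ0 G_eq \<psi>_eq V_def[symmetric] by simp
  moreover have "\<theta> / G * G / sqrt V = \<theta> * V powr (-1/2)"
  proof -
    have "V powr (-1/2) = inverse (sqrt V)"
      using V powr_minus[of V "1/2"] by (simp add: powr_half_sqrt)
    moreover have "\<theta> / G * G = \<theta>"
      using G_ne unfolding G_def[symmetric] by simp
    ultimately show ?thesis by (simp only: divide_inverse)
  qed
  ultimately have power: "(\<lambda>n. \<integral>\<omega>. \<psi> n \<omega> \<partial>sample_measure (P (t n)) (Q (t n)) (n1 n) (n2 n)) \<longlonglongrightarrow>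
      std_normal_cdf (\<theta> * V powr (-1/2) - u)"
    by simp
  have "std_normal_cdf (\<theta> * V powr (-1/2) - u) \<le> \<alpha>" if "\<theta> < 0"
  proof -
    have "\<theta> * V powr (-1/2) \<le> 0"
      using that by (intro mult_nonpos_nonneg) auto
    then have "std_normal_cdf (\<theta> * V powr (-1/2) - u) \<le> std_normal_cdf (- u)"
      by (intro monoD[OF mono_std_normal_cdf]) simp
    then show ?thesis by (simp add: null)
  qed
  with level power show ?thesis
    unfolding V_def u_def by blast
qed

end
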